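(* Let $\alpha\in(1,2)$ and $1/\alpha<H<1$. Let $\{X_{H,\alpha}(t)\}_{t\in\mathbb{R}}$ be the symmetric $\alpha$-stable linear fractional stable motion, let $\psi$ be a real-valued continuous function, not identically zero, supported in $[0,1]$, with $\int_{\mathbb{R}}\psi(s)\,ds=\int_{\mathbb{R}}s\psi(s)\,ds=0$, and let $d_{j,k}=2^j\int_{\mathbb{R}}X_{H,\alpha}(t)\psi(2^jt-k)\,dt$ and $D_j=\max_{0\le k<2^j}|d_{j,k}|$. Then, almost surely, for all arbitrarily small $\epsilon>0$, $$\liminf_{j\to+\infty}\left\{2^{j(H-1/\alpha+\epsilon)}D_j\right\}=\infty.$$
   Context: The linear fractional stable motion is defined for $t\in\mathbb{R}$ by $$X_{H,\alpha}(t)=\int_{\mathbb{R}}\Big\{(t-s)_+^{H-1/\alpha}-(-s)_+^{H-1/\alpha}\Big\}\,Z_\alpha(ds),$$ where $(z)_+=\max\{z,0\}$ and $Z_\alpha$ is a symmetric $\alpha$-stable random measure on $\mathbb{R}$ with Lebesgue control measure (so for $f\in L^\alpha(\mathbb{R})$, $\mathbb{E}\exp(i\theta\int f\,dZ_\alpha)=\exp(-|\theta|^\alpha\int|f(s)|^\alpha ds)$ for all $\theta\in\mathbb{R}$). Since $H>1/\alpha$, this process has a modification with continuous sample paths, and $X_{H,\alpha}$ is identified with this modification, so that the integrals defining $d_{j,k}$ are pathwise integrals. "Almost surely, for all $\epsilon$" means that there is one event of probability $1$ on which the relation holds for all such $\epsilon$. *)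

theory Defs
  imports "HOL-Probability.Probability"
begin

text \<open>
  A symmetric \<open>\<alpha>\<close>-stable random measure on the real line with Lebesgue control measure: an
  independently scattered, almost surely \<open>\<sigma>\<close>-additive set function on the Borel sets of finite
  Lebesgue measure, with \<open>Z A\<close> symmetric \<open>\<alpha>\<close>-stable of scale \<open>(measure lborel A) powr (1/\<alpha>)\<close>.
  Values of \<open>Z\<close> on any other set are unconstrained.
\<close>

definition finite_borel_sets :: "real set set" where
  "finite_borel_sets = {A \<in> sets borel. emeasure lborel A < \<infinity>}"

locale sas_random_measure = prob_space M for M :: "'a measure" +
  fixes \<alpha> :: real and Z :: "real set \<Rightarrow> 'a \<Rightarrow> real"
  assumes random_variable_Z: "A \<in> finite_borel_sets \<Longrightarrow> random_variable borel (Z A)"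
    and char_Z: "A \<in> finite_borel_sets \<Longrightarrow>
      char (distr M borel (Z A)) \<theta> = of_real (exp (- (\<bar>\<theta>\<bar> powr \<alpha> * measure lborel A)))"
    and indep_Z: "disjoint_family_on B {..<n::nat} \<Longrightarrow> B ` {..<n} \<subseteq> finite_borel_sets \<Longrightarrow>
      indep_vars (\<lambda>_. borel) (\<lambda>i. Z (B i)) {..<n}"
    and sigma_additive_Z: "disjoint_family (B :: nat \<Rightarrow> real set) \<Longrightarrow>
      range B \<subseteq> finite_borel_sets \<Longrightarrow> (\<Union>i. B i) \<in> finite_borel_sets \<Longrightarrow>
      AE \<omega> in M. (\<lambda>i. Z (B i) \<omega>) sums Z (\<Union>i. B i) \<omega>"

text \<open>
  The integral of a step function, and its extension to \<open>L\<^sup>\<alpha>\<close> by continuity: \<open>Y\<close> is a version of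
  the integral of \<open>f\<close> if it is the limit in probability of the integrals of step functions that
  converge to \<open>f\<close> in \<open>L\<^sup>\<alpha>\<close>. Such an \<open>f\<close> is itself in \<open>L\<^sup>\<alpha>\<close>, and \<open>Y\<close> is unique up to almost sure
  equality. The value 0 of a step function, whose preimage has infinite measure, contributes
  nothing to the sum below.
\<close>

definition simple_stable_integral ::
    "(real set \<Rightarrow> 'a \<Rightarrow> real) \<Rightarrow> (real \<Rightarrow> real) \<Rightarrow> 'a \<Rightarrow> real" where
  "simple_stable_integral Z f \<omega> = (\<Sum>c\<in>range f. c * Z {s. f s = c} \<omega>)"

definition has_stable_integral ::
    "'a measure \<Rightarrow> real \<Rightarrow> (real set \<Rightarrow> 'a \<Rightarrow> real) \<Rightarrow> (real \<Rightarrow> real) \<Rightarrow> ('a \<Rightarrow> real) \<Rightarrow> bool" where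
  "has_stable_integral M \<alpha> Z f Y \<longleftrightarrow>
     f \<in> borel_measurable borel \<and> Y \<in> borel_measurable M \<and>
     (\<exists>F :: nat \<Rightarrow> real \<Rightarrow> real.
        (\<forall>n. Bochner_Integration.simple_bochner_integrable lborel (F n)) \<and>
        (\<lambda>n. \<integral>\<^sup>+ s. ennreal (\<bar>F n s - f s\<bar> powr \<alpha>) \<partial>lborel) \<longlonglongrightarrow> 0 \<and>
        (\<forall>\<delta>>0. (\<lambda>n. measure M {\<omega> \<in> space M. \<bar>simple_stable_integral Z (F n) \<omega> - Y \<omega>\<bar> > \<delta>})
           \<longlonglongrightarrow> 0))"

definition lfsm_kernel :: "real \<Rightarrow> real \<Rightarrow> real \<Rightarrow> real \<Rightarrow> real" where
  "lfsm_kernel H \<alpha> t s = max (t - s) 0 powr (H - 1 / \<alpha>) - max (- s) 0 powr (H - 1 / \<alpha>)"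

text \<open>The modification of linear fractional stable motion with continuous sample paths.\<close>

definition linear_fractional_stable_motion ::
    "'a measure \<Rightarrow> real \<Rightarrow> real \<Rightarrow> (real set \<Rightarrow> 'a \<Rightarrow> real) \<Rightarrow> (real \<Rightarrow> 'a \<Rightarrow> real) \<Rightarrow> bool" where
  "linear_fractional_stable_motion M H \<alpha> Z X \<longleftrightarrow>
     (\<forall>t. has_stable_integral M \<alpha> Z (lfsm_kernel H \<alpha> t) (X t)) \<and>
     (\<forall>\<omega>\<in>space M. continuous_on UNIV (\<lambda>t. X t \<omega>))"

definition wavelet_coeff :: "(real \<Rightarrow> real) \<Rightarrow> (real \<Rightarrow> real) \<Rightarrow> nat \<Rightarrow> nat \<Rightarrow> real" where
  "wavelet_coeff \<psi> x j k = 2 ^ j * (LINT t|lborel. x t * \<psi> (2 ^ j * t - real k))"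

definition max_wavelet_coeff :: "(real \<Rightarrow> real) \<Rightarrow> (real \<Rightarrow> real) \<Rightarrow> nat \<Rightarrow> real" where
  "max_wavelet_coeff \<psi> x j = (MAX k\<in>{..<2 ^ j}. \<bar>wavelet_coeff \<psi> x j k\<bar>)"

end

(* Write kappa = H - 1/alpha. The coefficient d_{j,k} is a stable integral over (-oo, (k+1)/2^j]. Its part over the cell
   [k/2^j, (k+1)/2^j) is symmetric and independent of the rest of d_{j,k} and of all d_{j,i} with i < k. Conditionally on
   these, adding an independent symmetric N to a constant keeps the sum outside [-u, u] with probability at least
   P(|N| > u) / 2. Hence P(|d_{j,k}| <= u for all k < 2^j) is at most the product of the factors 1 - P(|N_k| > u) / 2.
   Here N_k is alpha-stable of scale const * 2^{-j/alpha} * 2^{-j kappa}, so that P(|N_k| > u) is at least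
   const * 2^{-j + j eps alpha} for u = 2^{-j (kappa + eps)}. The product is then at most exp(-const * 2^{j eps alpha}),
   and Borel-Cantelli applies.
   The scale of N_k is bounded below by testing the integrand of N_k against x^p on the rescaled cell. This linear
   functional maps (t - s)_+^kappa to a multiple of y^(kappa+1+p), y being the rescaled t, and some moment of psi against
   y^(kappa+1+p) is nonzero by the Weierstrass theorem.
   All this is done for step functions approximating d_{j,k}, so that only finitely many independent values of Z occur. *)

theory Submission
  imports Defs
begin

subsection \<open>Sums with independent symmetric increments\<close>

text \<open>Two demands on the approximating step functions shape the proof. They must vanish
  exactly, not just approximately, to the right of their cell, since the conditioning breaks down as
  soon as an earlier coefficient sees a later cell; hence they are cut off before use. They must
  also keep a lower bound for their scale on the cell. The integrand of d_{j,k} is never written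
  down, so such a bound cannot be read off from it. A bounded weight on the cell gives a linear
  functional that passes through Riemann sums in t and through L^\<alpha> limits alike, and a large
  value of it forces a large L^\<alpha> norm. Powers x^p are the natural weights because the kernel
  is homogeneous: each of them produces a single power of y. Approximation costs only a factor 2 in
  the threshold, because the failure probabilities can be made arbitrarily small for each fixed j.
  The probability estimate is made for \<epsilon> \<le> 1/2, where const * 2^{-j + j \<epsilon>
  \<alpha>} stays bounded; larger \<epsilon> only enlarge the normalising factor.\<close>

lemma (in prob_space) prob_abs_add_symmetric_le:
  fixes q :: "'b \<Rightarrow> real" and N :: "'a \<Rightarrow> real"
  assumes ind: "indep_var S Y T V" and q: "q \<in> borel_measurable T" and N_eq: "\<And>\<omega>. N \<omega> = q (V \<omega>)"
    and W: "W \<in> sets S" and p: "p \<in> borel_measurable S"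
    and sym: "prob {\<omega> \<in> space M. N \<omega> < - u} = prob {\<omega> \<in> space M. N \<omega> > u}" and u: "u \<ge> 0"
  shows "prob {\<omega> \<in> space M. Y \<omega> \<in> W \<and> \<bar>p (Y \<omega>) + N \<omega>\<bar> \<le> u} \<le>
    prob {\<omega> \<in> space M. Y \<omega> \<in> W} * (1 - prob {\<omega> \<in> space M. \<bar>N \<omega>\<bar> > u} / 2)"
proof -
  have Ym[measurable]: "Y \<in> measurable M S" and Vm[measurable]: "V \<in> measurable M T"
    using indep_var_rv1[OF ind] indep_var_rv2[OF ind] by auto
  note [measurable] = W p q
  have [measurable]: "N \<in> borel_measurable M" unfolding N_eq[abs_def] by measurable
  \<comment> \<open>The sign of \<open>p (Y \<omega>)\<close> selects a tail of \<open>N\<close>: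
    where it is nonnegative, N > u pushes the sum above u, and where it is negative, N < -u pushes
    it below -u. The two events are disjoint, and by independence each removes the fraction r =
    P(|N| > u) / 2 of its part of \<open>W\<close>.\<close>
  let ?Wp = "{y \<in> space S. y \<in> W \<and> p y \<ge> 0}" and ?Wm = "{y \<in> space S. y \<in> W \<and> p y < 0}"
  define r where "r = prob {\<omega> \<in> space M. N \<omega> > u}"
  have WS: "W \<subseteq> space S" using W by (rule sets.sets_into_space)
  have N: "prob {\<omega> \<in> space M. \<bar>N \<omega>\<bar> > u} = 2 * r"
  proof -
    have "{\<omega> \<in> space M. \<bar>N \<omega>\<bar> > u} = {\<omega> \<in> space M. N \<omega> > u} \<union> {\<omega> \<in> space M. N \<omega> < - u}"
      by auto
    also have "prob \<dots> = prob {\<omega> \<in> space M. N \<omega> > u} + prob {\<omega> \<in> space M. N \<omega> < - u}"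
      using u by (intro finite_measure_Union) auto
    finally show ?thesis using sym by (simp add: r_def)
  qed
  have prod: "prob {\<omega> \<in> space M. Y \<omega> \<in> A \<and> N \<omega> \<in> B} = prob {\<omega> \<in> space M. Y \<omega> \<in> A} * prob {\<omega> \<in> space M. N \<omega> \<in> B}"
    if "A \<in> sets S" "B \<in> sets borel" for A B
    proof -
    have B': "q -` B \<inter> space T \<in> sets T" by (rule measurable_sets[OF q that(2)])
    have "{\<omega> \<in> space M. Y \<omega> \<in> A \<and> N \<omega> \<in> B} = (\<lambda>\<omega>. (Y \<omega>, V \<omega>)) -` (A \<times> (q -` B \<inter> space T)) \<inter> space M"
      and "{\<omega> \<in> space M. Y \<omega> \<in> A} = Y -` A \<inter> space M"
      and "{\<omega> \<in> space M. N \<omega> \<in> B} = V -` (q -` B \<inter> space T) \<inter> space M"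
      using measurable_space[OF Vm] by (auto simp: N_eq)
    then show ?thesis using indep_varD[OF ind that(1) B'] by simp
  qed
  have p1: "prob {\<omega> \<in> space M. Y \<omega> \<in> ?Wp \<and> N \<omega> > u} = prob {\<omega> \<in> space M. Y \<omega> \<in> ?Wp} * r"
    using prod[of ?Wp "{u<..}"] by (simp add: r_def)
  have p2: "prob {\<omega> \<in> space M. Y \<omega> \<in> ?Wm \<and> N \<omega> < - u} = prob {\<omega> \<in> space M. Y \<omega> \<in> ?Wm} * r"
    using prod[of ?Wm "{..<-u}"] sym by (simp add: r_def)
  have split: "prob {\<omega> \<in> space M. Y \<omega> \<in> W} = prob {\<omega> \<in> space M. Y \<omega> \<in> ?Wp} + prob {\<omega> \<in> space M. Y \<omega> \<in> ?Wm}"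
  proof -
    have "{\<omega> \<in> space M. Y \<omega> \<in> W} = {\<omega> \<in> space M. Y \<omega> \<in> ?Wp} \<union> {\<omega> \<in> space M. Y \<omega> \<in> ?Wm}"
      using WS by (auto simp: not_le)
    also have "prob \<dots> = prob {\<omega> \<in> space M. Y \<omega> \<in> ?Wp} + prob {\<omega> \<in> space M. Y \<omega> \<in> ?Wm}"
      by (intro finite_measure_Union) auto
    finally show ?thesis .
  qed
  have "prob {\<omega> \<in> space M. Y \<omega> \<in> W \<and> \<bar>p (Y \<omega>) + N \<omega>\<bar> \<le> u} + prob {\<omega> \<in> space M. Y \<omega> \<in> W} * r
    = prob {\<omega> \<in> space M. Y \<omega> \<in> W \<and> \<bar>p (Y \<omega>) + N \<omega>\<bar> \<le> u} +
      (prob {\<omega> \<in> space M. Y \<omega> \<in> ?Wp \<and> N \<omega> > u} + prob {\<omega> \<in> space M. Y \<omega> \<in> ?Wm \<and> N \<omega> < - u})"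
    unfolding p1 p2 split by (simp add: algebra_simps)
  also have "\<dots> = prob {\<omega> \<in> space M. Y \<omega> \<in> W \<and> \<bar>p (Y \<omega>) + N \<omega>\<bar> \<le> u} +
      prob ({\<omega> \<in> space M. Y \<omega> \<in> ?Wp \<and> N \<omega> > u} \<union> {\<omega> \<in> space M. Y \<omega> \<in> ?Wm \<and> N \<omega> < - u})"
    by (subst finite_measure_Union) auto
  also have "\<dots> = prob ({\<omega> \<in> space M. Y \<omega> \<in> W \<and> \<bar>p (Y \<omega>) + N \<omega>\<bar> \<le> u} \<union>
      ({\<omega> \<in> space M. Y \<omega> \<in> ?Wp \<and> N \<omega> > u} \<union> {\<omega> \<in> space M. Y \<omega> \<in> ?Wm \<and> N \<omega> < - u}))"
    by (subst finite_measure_Union) auto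
  also have "\<dots> \<le> prob {\<omega> \<in> space M. Y \<omega> \<in> W}"
    by (intro finite_measure_mono) auto
  finally show ?thesis by (simp add: N algebra_simps)
qed

text \<open>The level \<open>l m\<close> makes the coefficient array triangular. In the step from K
  to K + 1, the variables of level below K form the past, which determines all earlier sums, those
  of level K form the new symmetric increment, and those of higher level do not enter.\<close>

lemma (in prob_space) prob_all_abs_le_prod:
  fixes \<xi> :: "nat \<Rightarrow> 'a \<Rightarrow> real" and c :: "nat \<Rightarrow> nat \<Rightarrow> real" and l :: "nat \<Rightarrow> nat"
  assumes ind: "indep_vars (\<lambda>_. borel) \<xi> {..<n}"
    and adapted: "\<And>k m. k < K \<Longrightarrow> m < n \<Longrightarrow> k < l m \<Longrightarrow> c k m = 0"
    and sym: "\<And>k. k < K \<Longrightarrow> prob {\<omega> \<in> space M. (\<Sum>m | m < n \<and> l m = k. c k m * \<xi> m \<omega>) < - u} =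
      prob {\<omega> \<in> space M. (\<Sum>m | m < n \<and> l m = k. c k m * \<xi> m \<omega>) > u}"
    and u: "u \<ge> 0"
  shows "prob {\<omega> \<in> space M. \<forall>k<K. \<bar>\<Sum>m<n. c k m * \<xi> m \<omega>\<bar> \<le> u} \<le>
    (\<Prod>k<K. 1 - prob {\<omega> \<in> space M. \<bar>\<Sum>m | m < n \<and> l m = k. c k m * \<xi> m \<omega>\<bar> > u} / 2)"
  using adapted sym
proof (induction K)
  case 0
  then show ?case by simp
next
  case (Suc K)
  define A where "A = {m. m < n \<and> l m < K}"
  define B where "B = {m. m < n \<and> l m = K}"
  define S where "S = PiM A (\<lambda>_::nat. borel :: real measure)"
  define Y where "Y = (\<lambda>\<omega>. restrict (\<lambda>m. \<xi> m \<omega>) A)"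
  define N where "N = (\<lambda>\<omega>. \<Sum>m\<in>B. c K m * \<xi> m \<omega>)"
  define p where "p = (\<lambda>k y. \<Sum>m\<in>A. c k m * (y m :: real))"
  define W where "W = {y \<in> space S. \<forall>k<K. \<bar>p k y\<bar> \<le> u}"
  have fin: "finite A" "finite B" by (auto simp: A_def B_def)
  have pm[measurable]: "p k \<in> borel_measurable S" for k unfolding p_def S_def by measurable
  have Wm: "W \<in> sets S" unfolding W_def by measurable
  define V where "V = (\<lambda>\<omega>. restrict (\<lambda>m. \<xi> m \<omega>) B)"
  define q where "q = (\<lambda>y. \<Sum>m\<in>B. c K m * (y m :: real))"
  have YV: "indep_var S Y (PiM B (\<lambda>_. borel)) V"
    unfolding S_def Y_def V_def by (intro indep_var_restrict[OF ind]) (auto simp: A_def B_def)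
  have qm: "q \<in> borel_measurable (PiM B (\<lambda>_. borel))" unfolding q_def by measurable
  have NqV: "N \<omega> = q (V \<omega>)" for \<omega> by (simp add: N_def q_def V_def)
  have past: "(\<Sum>m<n. c k m * \<xi> m \<omega>) = p k (Y \<omega>)" if "k < K" for k \<omega>
  proof -
    have "l m < K" if "m < n" "c k m \<noteq> 0" for m
      using Suc.prems(1)[of k m] that \<open>k < K\<close> by (cases "k < l m") auto
    then show ?thesis unfolding p_def Y_def
      by (intro sum.mono_neutral_cong_right) (auto simp: A_def)
  qed
  have cur: "(\<Sum>m<n. c K m * \<xi> m \<omega>) = p K (Y \<omega>) + N \<omega>" for \<omega>
  proof -
    have "l m < K \<or> l m = K" if "m < n" "c K m \<noteq> 0" for m
      using Suc.prems(1)[of K m] that by (cases "K < l m") auto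
    then have "(\<Sum>m<n. c K m * \<xi> m \<omega>) = (\<Sum>m\<in>A \<union> B. c K m * \<xi> m \<omega>)"
      by (intro sum.mono_neutral_cong_right) (auto simp: A_def B_def)
    also have "\<dots> = (\<Sum>m\<in>A. c K m * \<xi> m \<omega>) + N \<omega>"
      unfolding N_def by (rule sum.union_disjoint[OF fin]) (auto simp: A_def B_def)
    finally show ?thesis by (simp add: p_def Y_def)
  qed
  have Ysp: "Y \<omega> \<in> space S" if "\<omega> \<in> space M" for \<omega>
    by (auto simp: Y_def S_def space_PiM)
  have e1: "{\<omega> \<in> space M. \<forall>k<Suc K. \<bar>\<Sum>m<n. c k m * \<xi> m \<omega>\<bar> \<le> u} =
     {\<omega> \<in> space M. Y \<omega> \<in> W \<and> \<bar>p K (Y \<omega>) + N \<omega>\<bar> \<le> u}"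
    using Ysp by (auto simp: less_Suc_eq W_def past cur)
  have e2: "{\<omega> \<in> space M. \<forall>k<K. \<bar>\<Sum>m<n. c k m * \<xi> m \<omega>\<bar> \<le> u} = {\<omega> \<in> space M. Y \<omega> \<in> W}"
    using Ysp by (auto simp: W_def past)
  have symN: "prob {\<omega> \<in> space M. N \<omega> < - u} = prob {\<omega> \<in> space M. N \<omega> > u}"
    using Suc.prems(2)[of K] by (simp add: N_def B_def)
  have "prob {\<omega> \<in> space M. \<forall>k<Suc K. \<bar>\<Sum>m<n. c k m * \<xi> m \<omega>\<bar> \<le> u} \<le>
     prob {\<omega> \<in> space M. Y \<omega> \<in> W} * (1 - prob {\<omega> \<in> space M. \<bar>N \<omega>\<bar> > u} / 2)"
    unfolding e1 by (rule prob_abs_add_symmetric_le[OF YV qm NqV Wm pm symN u])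
  also have "\<dots> \<le> (\<Prod>k<K. 1 - prob {\<omega> \<in> space M. \<bar>\<Sum>m | m < n \<and> l m = k. c k m * \<xi> m \<omega>\<bar> > u} / 2) *
      (1 - prob {\<omega> \<in> space M. \<bar>N \<omega>\<bar> > u} / 2)"
  proof (rule mult_right_mono)
    show "0 \<le> 1 - prob {\<omega> \<in> space M. \<bar>N \<omega>\<bar> > u} / 2"
      using prob_le_1[of "{\<omega> \<in> space M. \<bar>N \<omega>\<bar> > u}"] by linarith
  qed (use Suc.IH Suc.prems in \<open>simp add: e2\<close>)
  finally show ?case by (simp add: N_def B_def)
qed

subsection \<open>Tails of symmetric stable laws\<close>

lemma one_minus_cos_ge:
  fixes x :: real
  assumes "\<bar>x\<bar> \<le> 1"
  shows "x\<^sup>2 / 4 \<le> 1 - cos x"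
proof -
  have "cos x = 1 - 2 * (sin (x/2))\<^sup>2" using cos_double_sin[of "x/2"] by simp
  moreover have "x\<^sup>2/4 \<le> 2 * (sin (x/2))\<^sup>2"
  proof -
    define y where "y = \<bar>x\<bar> / 2"
    have y: "0 \<le> y" "y \<le> 1/2" using assms by (auto simp: y_def)
    have "y ^ 3 \<le> y / 4" using mult_mono[of "y" "1/2" y "1/2"] mult_left_mono[of "y * y" "1/4" y] y
      by (simp add: power3_eq_cube mult.assoc)
    moreover have "\<bar>sin y - y\<bar> \<le> y ^ 3 / 6" using Maclaurin_sin_bound[of y 3] y
      by (simp add: sin_coeff_def eval_nat_numeral)
    \<comment> \<open>For y \<le> 1/2 the Taylor error y^3 / 6 is at most y / 24. Then 2 sin(x/2)^2
      \<ge> (529/1152) x^2, which still exceeds x^2 / 4.\<close>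
    ultimately have "sin y \<ge> 23/24 * y" by linarith
    then have "(23/24 * y)\<^sup>2 \<le> (sin y)\<^sup>2" using y by (intro power_mono) auto
    moreover have "(sin (x/2))\<^sup>2 = (sin y)\<^sup>2" by (cases "x \<ge> 0") (auto simp: y_def)
    moreover have "y\<^sup>2 = x\<^sup>2 / 4" by (simp add: y_def power_divide)
    ultimately have "529 * x\<^sup>2 \<le> (sin (x/2))\<^sup>2 * 2304"
      by (simp add: power_mult_distrib power_divide)
    then show ?thesis using zero_le_power2[of x] by linarith
  qed
  ultimately show ?thesis by simp
qed

text \<open>Two cosines are compared: 1 - cos(x N / u) is at most 2 on the tail and, because z^2 / 4
  \<le> 1 - cos z for |z| \<le> 1 and 1 - cos z \<le> z^2 / 2 always, at most 2 x^2 (1 - cos(N / u))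
  off the tail. Both expectations are explicit through the characteristic function, so the tail is
  bounded below without a density.\<close>

lemma (in prob_space) stable_tail_lower:
  fixes N :: "'a \<Rightarrow> real"
  assumes rv[measurable]: "random_variable borel N"
    and char: "\<And>\<theta>. char (distr M borel N) \<theta> = of_real (exp (- (a * \<bar>\<theta>\<bar> powr \<alpha>)))"
    and u: "u > 0" and x: "x > 0"
  shows "1 - exp (- (a * (x / u) powr \<alpha>)) \<le>
    2 * x\<^sup>2 * (1 - exp (- (a * (1 / u) powr \<alpha>))) + 2 * prob {\<omega> \<in> space M. \<bar>N \<omega>\<bar> > u}"
proof -
  have E: "expectation (\<lambda>\<omega>. 1 - cos (\<theta> * N \<omega>)) = 1 - exp (- (a * \<bar>\<theta>\<bar> powr \<alpha>))" for \<theta>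
  proof -
    have "integrable M (\<lambda>\<omega>. iexp (\<theta> * N \<omega>))" by (rule integrable_const_bound[of _ 1]) auto
    moreover have "char (distr M borel N) \<theta> = expectation (\<lambda>\<omega>. iexp (\<theta> * N \<omega>))"
      unfolding char_def by (subst integral_distr) auto
    ultimately have "Re (char (distr M borel N) \<theta>) = expectation (\<lambda>\<omega>. cos (\<theta> * N \<omega>))"
      by (simp add: Re_exp flip: integral_Re)
    then have "expectation (\<lambda>\<omega>. cos (\<theta> * N \<omega>)) = exp (- (a * \<bar>\<theta>\<bar> powr \<alpha>))" by (simp add: char)
    moreover have "integrable M (\<lambda>\<omega>. cos (\<theta> * N \<omega>))" by (rule integrable_const_bound[of _ 1]) auto
    ultimately show ?thesis by (simp add: prob_space)
  qed
  have I: "integrable M (\<lambda>\<omega>. 1 - cos (\<theta> * N \<omega>))" for \<theta>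
    by (rule integrable_const_bound[of _ 2]) (auto intro!: AE_I2 order_trans[OF abs_triangle_ineq4] simp: abs_cos_le_one)
  let ?E = "{\<omega> \<in> space M. \<bar>N \<omega>\<bar> > u}"
  have Ii: "integrable M (indicator ?E :: _ \<Rightarrow> real)" by (intro integrable_real_indicator) (auto simp: less_top[symmetric])
  have pw: "1 - cos (x / u * N \<omega>) \<le> 2 * x\<^sup>2 * (1 - cos (1 / u * N \<omega>)) + 2 * indicator ?E \<omega>"
    if "\<omega> \<in> space M" for \<omega>
  proof (cases "\<bar>N \<omega>\<bar> > u")
    case True
    have "1 - cos (x / u * N \<omega>) \<le> 2" using cos_ge_minus_one[of "x / u * N \<omega>"] by linarith
    moreover have "0 \<le> 2 * x\<^sup>2 * (1 - cos (1 / u * N \<omega>))" by simp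
    moreover have "indicator ?E \<omega> = (1 :: real)" using True that by simp
    ultimately show ?thesis by linarith
  next
    case False
    have "1 - cos (x / u * N \<omega>) \<le> (x / u * N \<omega>)\<^sup>2 / 2"
    proof -
      define z where "z = x / u * N \<omega>"
      have "1 - cos z = 2 * \<bar>sin (z / 2)\<bar>\<^sup>2" using cos_double_sin[of "z/2"] by simp
      also have "\<dots> \<le> 2 * \<bar>z / 2\<bar>\<^sup>2"
        by (intro mult_left_mono power_mono abs_sin_x_le_abs_x) auto
      finally show ?thesis unfolding z_def[symmetric] by (simp add: power_divide)
    qed
    also have "\<dots> = 2 * x\<^sup>2 * ((1 / u * N \<omega>)\<^sup>2 / 4)" by (simp add: power_mult_distrib power_divide)
    also have "\<dots> \<le> 2 * x\<^sup>2 * (1 - cos (1 / u * N \<omega>))"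
      using False u by (intro mult_left_mono one_minus_cos_ge) (auto simp: field_simps)
    finally show ?thesis by (simp add: False)
  qed
  have "expectation (\<lambda>\<omega>. 1 - cos (x / u * N \<omega>)) \<le>
      expectation (\<lambda>\<omega>. 2 * x\<^sup>2 * (1 - cos (1 / u * N \<omega>)) + 2 * indicator ?E \<omega>)"
    by (intro integral_mono Bochner_Integration.integrable_add integrable_mult_right I Ii pw)
  also have "\<dots> = 2 * x\<^sup>2 * expectation (\<lambda>\<omega>. 1 - cos (1 / u * N \<omega>)) + 2 * prob ?E"
    using I[of "1 / u"] Ii
    by (subst Bochner_Integration.integral_add)
      (auto simp del: times_divide_eq_left intro!: integrable_mult_right)
  finally show ?thesis using u x by (simp only: E) simp
qed

text \<open>In \<open>stable_tail_lower\<close> the left side is of order B x^\<alpha> and the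
  competing term of order B x^2. Since \<alpha> < 2, a fixed small x makes the first dominate,
  whatever the scale. Hence \<open>c\<close> is the same for all \<open>N\<close>, \<open>a\<close>,
  \<open>u\<close> and \<open>B\<close>.\<close>

lemma (in prob_space) stable_tail_ge:
  fixes \<alpha> :: real
  assumes \<alpha>: "1 < \<alpha>" "\<alpha> < 2"
  shows "\<exists>c>0. c \<le> 1 \<and> (\<forall>N a u B. random_variable borel N \<longrightarrow>
     (\<forall>\<theta>. char (distr M borel N) \<theta> = of_real (exp (- (a * \<bar>\<theta>\<bar> powr \<alpha>)))) \<longrightarrow>
     0 < u \<longrightarrow> 0 < B \<longrightarrow> B \<le> 1 \<longrightarrow> B * u powr \<alpha> \<le> a \<longrightarrow>
     c * B \<le> prob {\<omega> \<in> space M. \<bar>N \<omega>\<bar> > u})"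
proof -
  \<comment> \<open>With this \<open>x\<close>, the truncated second moment takes up half of the available \<open>B * x powr \<alpha> / 2\<close>.\<close>
  define x :: real where "x = (1/8) powr (1 / (2 - \<alpha>))"
  have x: "0 < x" "x \<le> 1" using \<alpha> by (auto simp: x_def powr_le1)
  have "x powr (2 - \<alpha>) = 1/8" using \<alpha> by (simp add: x_def powr_powr)
  then have xx: "x\<^sup>2 = x powr \<alpha> / 8" using x
    by (simp add: powr_diff powr_numeral field_simps)
  \<comment> \<open>B x^\<alpha> / 2 less the second-moment term leaves B x^\<alpha> / 4, and the
    probability carries a factor 2.\<close>
  define c where "c = x powr \<alpha> / 8"
  have c: "0 < c" "c \<le> 1" using x powr_le1[of \<alpha> x] \<alpha> by (auto simp: c_def)
  have "c * B \<le> prob {\<omega> \<in> space M. \<bar>N \<omega>\<bar> > u}"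
    if N[measurable]: "random_variable borel N"
      and char: "\<And>\<theta>. char (distr M borel N) \<theta> = of_real (exp (- (a * \<bar>\<theta>\<bar> powr \<alpha>)))"
      and u: "0 < u" and B: "0 < B" "B \<le> 1" and a: "B * u powr \<alpha> \<le> a" for N a u B
  proof -
    \<comment> \<open>Enlarging \<open>u\<close> to \<open>v\<close> makes \<open>B\<close> the exact scale.\<close>
    define v where "v = (a / B) powr (1 / \<alpha>)"
    have "0 < B * u powr \<alpha>" using B u by simp
    then have a0: "a > 0" using a by linarith
    have v0: "v > 0" using a0 B by (simp add: v_def)
    have "u = (u powr \<alpha>) powr (1 / \<alpha>)" using u \<alpha> by (simp add: powr_powr)
    also have "\<dots> \<le> v" unfolding v_def using B \<alpha> a by (intro powr_mono2) (auto simp: field_simps)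
    finally have uv: "u \<le> v" .
    have va: "v powr \<alpha> = a / B" using a0 B \<alpha> by (simp add: v_def powr_powr)
    have A1: "a * (1 / v) powr \<alpha> = B" using va v0 a0 B by (simp add: powr_divide)
    have Ax: "a * (x / v) powr \<alpha> = B * x powr \<alpha>" using va v0 a0 B x by (simp add: powr_divide field_simps)
    have "1 - exp (- (B * x powr \<alpha>)) \<le> 2 * x\<^sup>2 * (1 - exp (- B)) + 2 * prob {\<omega> \<in> space M. \<bar>N \<omega>\<bar> > v}"
      using stable_tail_lower[OF N char v0 x(1)] unfolding A1 Ax .
    moreover have "1 - exp (- B) \<le> B" using exp_ge_add_one_self[of "-B"] by simp
    then have "2 * x\<^sup>2 * (1 - exp (- B)) \<le> 2 * x\<^sup>2 * B" by (intro mult_left_mono) auto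
    moreover have "B * x powr \<alpha> / 2 \<le> 1 - exp (- (B * x powr \<alpha>))"
    proof -
      define y where "y = B * x powr \<alpha>"
      have y: "0 \<le> y" "y \<le> 1" using B x powr_le1[of \<alpha> x] \<alpha> by (auto simp: y_def intro!: mult_le_one)
      have "exp (-y) \<le> 1 / (1 + y)" using exp_ge_add_one_self[of y] y by (simp add: exp_minus field_simps)
      also have "\<dots> \<le> 1 - y / 2" using y mult_left_le[of y y] by (simp add: field_simps power2_eq_square)
      finally show ?thesis by (simp add: y_def)
    qed
    ultimately have "B * x powr \<alpha> / 2 \<le> 2 * (x powr \<alpha> / 8) * B + 2 * prob {\<omega> \<in> space M. \<bar>N \<omega>\<bar> > v}"
      unfolding xx by linarith
    then have "c * B \<le> prob {\<omega> \<in> space M. \<bar>N \<omega>\<bar> > v}" by (simp add: c_def field_simps)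
    also have "\<dots> \<le> prob {\<omega> \<in> space M. \<bar>N \<omega>\<bar> > u}"
      using uv by (intro finite_measure_mono) auto
    finally show ?thesis .
  qed
  then show ?thesis using c by blast
qed

subsection \<open>Integrals of step functions\<close>

text \<open>The atoms are the level sets of the joint map of all \<open>f i\<close> and
  \<open>g\<close>, restricted to those where some \<open>f i\<close> is nonzero. This restriction
  gives them finite measure, so that \<open>Z\<close> is controlled on them. Including
  \<open>g\<close> places every atom in a single level.\<close>

lemma common_atoms:
  fixes f :: "'i \<Rightarrow> real \<Rightarrow> real" and g :: "real \<Rightarrow> nat"
  assumes I: "finite I" and f: "\<And>i. i \<in> I \<Longrightarrow> Bochner_Integration.simple_bochner_integrable lborel (f i)"
    and g: "simple_function lborel g"
  obtains n :: nat and B c l where "disjoint_family_on B {..<n}" "B ` {..<n} \<subseteq> finite_borel_sets"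
    "\<And>m. m < n \<Longrightarrow> B m \<noteq> {}"
    "\<And>i. i \<in> I \<Longrightarrow> f i = (\<lambda>s. \<Sum>m<n. c i m * indicator (B m) s)"
    "\<And>m s. m < n \<Longrightarrow> s \<in> B m \<Longrightarrow> g s = l m"
    "\<And>i m s. i \<in> I \<Longrightarrow> m < n \<Longrightarrow> s \<in> B m \<Longrightarrow> f i s = c i m"
proof -
  define V where "V = (\<lambda>s. (\<lambda>i\<in>I. f i s, g s))"
  define J where "J = {v \<in> range V. \<exists>i\<in>I. fst v i \<noteq> 0}"
  have sf: "simple_function lborel (f i)" if "i \<in> I" for i
    using f[OF that] by (auto elim: simple_bochner_integrable.cases)
  have supp: "emeasure lborel {s. f i s \<noteq> 0} \<noteq> \<infinity>" if "i \<in> I" for i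
    using f[OF that] by (auto elim: simple_bochner_integrable.cases)
  have [measurable]: "f i \<in> borel_measurable borel" if "i \<in> I" for i
    using borel_measurable_simple_function[OF sf[OF that]] by simp
  have [measurable]: "g \<in> measurable borel (count_space UNIV)"
    using measurable_simple_function[OF g] by simp
  have "range V \<subseteq> (PiE I (\<lambda>i. range (f i))) \<times> range g" by (auto simp: V_def)
  moreover have "finite (PiE I (\<lambda>i. range (f i)))"
    using I sf by (intro finite_PiE) (auto simp: simple_function_def)
  moreover have "finite (range g)" using g by (auto simp: simple_function_def)
  ultimately have "finite (range V)" by (meson finite_SigmaI finite_subset)
  then have finJ: "finite J" by (auto simp: J_def)
  obtain e where e: "bij_betw e {..<card J} J"
    using ex_bij_betw_nat_finite[OF finJ] by (auto simp: atLeast0LessThan)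
  define n where "n = card J"
  define B where "B = (\<lambda>m. V -` {e m})"
  define c where "c = (\<lambda>i m. fst (e m) i)"
  define l where "l = (\<lambda>m. snd (e m))"
  have eJ: "e m \<in> J" if "m < n" for m using e that by (auto simp: n_def bij_betw_def)
  have inj: "m = m'" if "e m = e m'" "m < n" "m' < n" for m m'
    using e that by (auto simp: n_def bij_betw_def inj_on_def)
  show thesis
  proof
    show "disjoint_family_on B {..<n}"
      by (auto simp: disjoint_family_on_def B_def dest: inj)
    show "B m \<noteq> {}" if "m < n" for m using eJ[OF that] by (auto simp: J_def B_def)
    show gl: "g s = l m" if "m < n" "s \<in> B m" for m s
    proof -
      have "e m = V s" using that by (simp add: B_def)
      then show ?thesis by (simp add: l_def V_def)
    qed
    show fc: "f i s = c i m" if "i \<in> I" "m < n" "s \<in> B m" for i m s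
    proof -
      have "e m = V s" using that by (simp add: B_def)
      then show ?thesis using that(1) by (simp add: c_def V_def)
    qed
    show "f i = (\<lambda>s. \<Sum>m<n. c i m * indicator (B m) s)" if i: "i \<in> I" for i
    proof
      fix s
      show "f i s = (\<Sum>m<n. c i m * indicator (B m) s)"
      proof (cases "V s \<in> J")
        case True
        then obtain m where m: "m < n" "V s = e m"
          using e by (auto simp: n_def bij_betw_def image_iff)
        then have "(\<Sum>m<n. c i m * indicator (B m) s) = (\<Sum>m'<n. if m' = m then c i m else 0)"
          by (intro sum.cong) (auto simp: B_def indicator_def dest: inj)
        also have "\<dots> = f i s" using m i fc[of i m s] by (simp add: B_def)
        finally show ?thesis by simp
      next
        case False
        then have "f i s = 0" using i by (auto simp: J_def V_def)
        moreover have "indicator (B m) s = (0 :: real)" if "m < n" for m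
          using False eJ[OF that] by (auto simp: B_def indicator_def)
        ultimately show ?thesis by simp
      qed
    qed
    show "B ` {..<n} \<subseteq> finite_borel_sets"
    proof safe
      fix m assume m: "m < n"
      have "B m = {s \<in> space borel. (\<forall>i\<in>I. f i s = fst (e m) i) \<and> g s = snd (e m)}"
      proof -
        have "fst (e m) \<in> extensional I" using eJ[OF m] by (auto simp: J_def V_def)
        then have "(\<lambda>i\<in>I. f i s) = fst (e m)" if "\<forall>i\<in>I. f i s = fst (e m) i" for s
          using that by (intro extensionalityI[of _ I]) auto
        moreover have "f i s = fst (e m) i" if "(\<lambda>i\<in>I. f i s) = fst (e m)" "i \<in> I" for i s
          using fun_cong[OF that(1), of i] that(2) by simp
        ultimately have "(\<lambda>i\<in>I. f i s) = fst (e m) \<longleftrightarrow> (\<forall>i\<in>I. f i s = fst (e m) i)" for s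
          by blast
        then show ?thesis by (simp add: B_def V_def prod_eq_iff vimage_def)
      qed
      also have "\<dots> \<in> sets borel" using I by measurable
      finally have Bm: "B m \<in> sets borel" .
      obtain i where i: "i \<in> I" "fst (e m) i \<noteq> 0" using eJ[OF m] by (auto simp: J_def)
      then have "B m \<subseteq> {s. f i s \<noteq> 0}" using fc[OF i(1) m] by (auto simp: c_def)
      then have "emeasure lborel (B m) \<le> emeasure lborel {s. f i s \<noteq> 0}"
        using i by (intro emeasure_mono) auto
      then show "B m \<in> finite_borel_sets" using supp[OF i(1)] Bm
        by (auto simp: finite_borel_sets_def less_top top_unique)
    qed
  qed
qed

lemma powr_abs_sum_indicator:
  fixes n :: nat
  assumes B: "disjoint_family_on B {..<n}" 
  shows "\<bar>\<Sum>m<n. c m * indicator (B m) s\<bar> powr \<alpha> = (\<Sum>m<n. \<bar>c m :: real\<bar> powr \<alpha> * indicator (B m) (s :: real))"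
proof (cases "\<exists>m<n. s \<in> B m")
  case True
  then obtain m where m: "m < n" "s \<in> B m" by auto
  have eq: "indicator (B m') s = (if m' = m then 1 else 0 :: real)" if "m' < n" for m'
    using B m that by (auto simp: disjoint_family_on_def indicator_def)
  have "(\<Sum>m<n. c m * indicator (B m) s) = (\<Sum>m'<n. if m' = m then c m' else 0)"
       "(\<Sum>m<n. \<bar>c m\<bar> powr \<alpha> * indicator (B m) s) = (\<Sum>m'<n. if m' = m then \<bar>c m'\<bar> powr \<alpha> else 0)"
    by (rule sum.cong; simp add: eq)+
  then show ?thesis using m by (simp add: sum.delta)
next
  case False
  then show ?thesis by simp
qed

lemma nn_integral_powr_atoms:
  fixes B :: "nat \<Rightarrow> real set"
  assumes "disjoint_family_on B {..<n}" "B ` {..<n} \<subseteq> finite_borel_sets"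
  shows "(\<integral>\<^sup>+ s. ennreal (\<bar>\<Sum>m<n. c m * indicator (B m) s\<bar> powr \<alpha>) \<partial>lborel) =
    ennreal (\<Sum>m<n. \<bar>c m\<bar> powr \<alpha> * measure lborel (B m))"
proof -
  have B[measurable]: "B m \<in> sets borel" and fin: "emeasure lborel (B m) \<noteq> \<infinity>" if "m < n" for m
    using assms(2) that by (auto simp: finite_borel_sets_def)
  have "(\<integral>\<^sup>+ s. ennreal (\<bar>\<Sum>m<n. c m * indicator (B m) s\<bar> powr \<alpha>) \<partial>lborel) =
     (\<integral>\<^sup>+ s. (\<Sum>m<n. ennreal (\<bar>c m\<bar> powr \<alpha>) * indicator (B m) s) \<partial>lborel)"
    unfolding powr_abs_sum_indicator[OF assms(1)]
    by (intro nn_integral_cong, subst sum_ennreal[symmetric])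
      (auto simp del: sum_ennreal simp: ennreal_mult ennreal_indicator)
  also have "\<dots> = (\<Sum>m<n. ennreal (\<bar>c m\<bar> powr \<alpha>) * emeasure lborel (B m))"
    by (subst nn_integral_sum) (auto intro!: sum.cong nn_integral_cmult_indicator B)
  also have "\<dots> = (\<Sum>m<n. ennreal (\<bar>c m\<bar> powr \<alpha> * measure lborel (B m)))"
    by (intro sum.cong refl) (use fin in \<open>auto simp: ennreal_mult emeasure_eq_ennreal_measure\<close>)
  finally show ?thesis by (simp add: sum_ennreal)
qed

context sas_random_measure
begin

lemma empty_in_finite_borel_sets [simp]: "{} \<in> finite_borel_sets"
  by (simp add: finite_borel_sets_def)

text \<open>The empty set is a disjoint union of infinitely many copies of itself, and a constant
  series converges only if its terms are 0.\<close>

lemma AE_Z_empty: "AE \<omega> in M. Z {} \<omega> = 0"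
proof -
  have "AE \<omega> in M. (\<lambda>i::nat. Z {} \<omega>) sums Z (\<Union>i::nat. {}) \<omega>"
    by (intro sigma_additive_Z) (auto simp: disjoint_family_on_def)
  then show ?thesis
  proof eventually_elim
    case (elim \<omega>)
    then have "(\<lambda>i::nat. Z {} \<omega>) \<longlonglongrightarrow> 0" by (intro summable_LIMSEQ_zero sums_summable)
    then show ?case by (simp add: LIMSEQ_const_iff)
  qed
qed

lemma AE_Z_finite_Union:
  fixes B :: "nat \<Rightarrow> real set"
  assumes B: "disjoint_family_on B J" "B ` J \<subseteq> finite_borel_sets" and J: "finite J"
  shows "AE \<omega> in M. Z (\<Union>m\<in>J. B m) \<omega> = (\<Sum>m\<in>J. Z (B m) \<omega>)"
proof -
  \<comment> \<open>Padding with empty sets makes the family countable, as \<sigma>-additivity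
    requires; by \<open>AE_Z_empty\<close> the series is then a finite sum.\<close>
  define B' where "B' = (\<lambda>m. if m \<in> J then B m else {})"
  have U: "(\<Union>m. B' m) = (\<Union>m\<in>J. B m)" by (auto simp: B'_def split: if_splits)
  have "emeasure lborel (\<Union>m\<in>J. B m) \<le> (\<Sum>m\<in>J. emeasure lborel (B m))"
    using B J by (intro emeasure_subadditive_finite) (auto simp: finite_borel_sets_def)
  also have "\<dots> < \<infinity>" using B J by (auto simp: finite_borel_sets_def)
  finally have UF: "(\<Union>m\<in>J. B m) \<in> finite_borel_sets"
    using B J by (auto simp: finite_borel_sets_def)
  have "AE \<omega> in M. (\<lambda>m. Z (B' m) \<omega>) sums Z (\<Union>m. B' m) \<omega>"
  proof (rule sigma_additive_Z)
    show "disjoint_family B'" using B(1) by (simp add: B'_def disjoint_family_on_def)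
    show "range B' \<subseteq> finite_borel_sets" using B(2) by (auto simp: B'_def)
    show "(\<Union>m. B' m) \<in> finite_borel_sets" unfolding U by (rule UF)
  qed
  then show ?thesis using AE_Z_empty
  proof eventually_elim
    case (elim \<omega>)
    have "(\<lambda>m. Z (B' m) \<omega>) sums (\<Sum>m\<in>J. Z (B' m) \<omega>)"
      using J elim(2) by (intro sums_finite) (auto simp: B'_def)
    then show ?case using elim(1) sums_unique2 by (fastforce simp: U B'_def)
  qed
qed

text \<open>The integral is defined by the values of \<open>f\<close>, while several atoms may carry
  the same value. Atoms of equal coefficient are merged by the additivity of \<open>Z\<close>, which
  holds only almost surely. The value 0 is exempt: its level set is no union of atoms, but its
  factor removes it.\<close>

lemma simple_stable_integral_atoms:
  fixes B :: "nat \<Rightarrow> real set"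
  assumes B: "disjoint_family_on B {..<n}" "B ` {..<n} \<subseteq> finite_borel_sets" "\<And>m. m < n \<Longrightarrow> B m \<noteq> {}"
    and f: "f = (\<lambda>s. \<Sum>m<n. c m * indicator (B m) s)"
  shows "AE \<omega> in M. simple_stable_integral Z f \<omega> = (\<Sum>m<n. c m * Z (B m) \<omega>)"
proof -
  have fB: "f s = c m" if "m < n" "s \<in> B m" for m s
  proof -
    have "f s = (\<Sum>m'<n. if m' = m then c m' else 0)"
      unfolding f using B(1) that by (intro sum.cong) (auto simp: disjoint_family_on_def indicator_def)
    then show ?thesis using that by simp
  qed
  have f0: "f s = 0" if "\<And>m. m < n \<Longrightarrow> s \<notin> B m" for s
    unfolding f by (rule sum.neutral) (use that in \<open>auto simp: indicator_def\<close>)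
  define J where "J = (\<lambda>y. {m. m < n \<and> c m = y})"
  have "range f \<subseteq> insert 0 (c ` {..<n})"
  proof clarify
    fix s assume "f s \<notin> c ` {..<n}"
    then show "f s = 0" using fB f0 by (metis imageI lessThan_iff)
  qed
  then have fin: "finite (range f)" by (rule finite_subset) auto
  have level: "{s. f s = y} = (\<Union>m\<in>J y. B m)" if "y \<noteq> 0" for y
    using fB f0 that by (auto simp: J_def) metis
  have sub: "disjoint_family_on B (J y)" "B ` J y \<subseteq> finite_borel_sets" "finite (J y)" for y
    using B by (auto simp: J_def disjoint_family_on_def)
  have "AE \<omega> in M. \<forall>y\<in>range f. Z (\<Union>m\<in>J y. B m) \<omega> = (\<Sum>m\<in>J y. Z (B m) \<omega>)"
    using fin sub by (intro AE_finite_allI AE_Z_finite_Union) auto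
  then show ?thesis
  proof eventually_elim
    case (elim \<omega>)
    have "simple_stable_integral Z f \<omega> = (\<Sum>y\<in>range f. \<Sum>m\<in>J y. c m * Z (B m) \<omega>)"
      unfolding simple_stable_integral_def
    proof (rule sum.cong[OF refl])
      fix y assume y: "y \<in> range f"
      have "y * Z {s. f s = y} \<omega> = y * (\<Sum>m\<in>J y. Z (B m) \<omega>)"
        using elim y level by (cases "y = 0") auto
      then show "y * Z {s. f s = y} \<omega> = (\<Sum>m\<in>J y. c m * Z (B m) \<omega>)"
        by (simp add: sum_distrib_left J_def)
    qed
    also have "\<dots> = (\<Sum>y\<in>range f. \<Sum>m | m \<in> {..<n} \<and> c m = y. c m * Z (B m) \<omega>)"
      by (simp add: J_def)
    also have "\<dots> = (\<Sum>m<n. c m * Z (B m) \<omega>)"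
    proof (rule sum.group)
      \<comment> \<open>Nonempty atoms make every coefficient a value of \<open>f\<close>, so that
        no group is missing from the sum over \<open>range f\<close>.\<close>
      show "c ` {..<n} \<subseteq> range f" using B(3) fB by (auto simp: image_iff) (metis equals0I)
    qed (use fin in auto)
    finally show ?case .
  qed
qed

lemma char_sum_atoms:
  fixes B :: "nat \<Rightarrow> real set"
  assumes B: "disjoint_family_on B {..<n}" "B ` {..<n} \<subseteq> finite_borel_sets" and J: "J \<subseteq> {..<n}"
  shows "char (distr M borel (\<lambda>\<omega>. \<Sum>m\<in>J. c m * Z (B m) \<omega>)) \<theta> =
    of_real (exp (- ((\<Sum>m\<in>J. \<bar>c m\<bar> powr \<alpha> * measure lborel (B m)) * \<bar>\<theta>\<bar> powr \<alpha>)))"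
proof -
  have fJ: "finite J" using J finite_subset by auto
  have BJ: "B m \<in> finite_borel_sets" if "m \<in> J" for m using B J that by auto
  have "indep_vars (\<lambda>_. borel) (\<lambda>m. Z (B m)) J"
    by (rule indep_vars_subset[OF indep_Z[OF B] J])
  then have "indep_vars (\<lambda>_. borel) (\<lambda>m \<omega>. c m * Z (B m) \<omega>) J"
    by (rule indep_vars_compose2) auto
  then have "char (distr M borel (\<lambda>\<omega>. \<Sum>m\<in>J. c m * Z (B m) \<omega>)) \<theta> =
     (\<Prod>m\<in>J. char (distr M borel (\<lambda>\<omega>. c m * Z (B m) \<omega>)) \<theta>)"
    by (rule char_distr_sum)
  also have "\<dots> = (\<Prod>m\<in>J. of_real (exp (- (\<bar>c m\<bar> powr \<alpha> * measure lborel (B m) * \<bar>\<theta>\<bar> powr \<alpha>))))"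
  proof (rule prod.cong[OF refl])
    fix m assume m: "m \<in> J"
    note [measurable] = random_variable_Z[OF BJ[OF m]]
    have "char (distr M borel (\<lambda>\<omega>. c m * Z (B m) \<omega>)) \<theta> = char (distr M borel (Z (B m))) (c m * \<theta>)"
      unfolding char_def by (subst (1 2) integral_distr) (auto simp: mult_ac)
    then show "char (distr M borel (\<lambda>\<omega>. c m * Z (B m) \<omega>)) \<theta> =
      of_real (exp (- (\<bar>c m\<bar> powr \<alpha> * measure lborel (B m) * \<bar>\<theta>\<bar> powr \<alpha>)))"
      using char_Z[OF BJ[OF m]] by (simp add: abs_mult powr_mult mult_ac)
  qed
  also have "\<dots> = of_real (exp (\<Sum>m\<in>J. - (\<bar>c m\<bar> powr \<alpha> * measure lborel (B m) * \<bar>\<theta>\<bar> powr \<alpha>)))"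
    by (simp only: of_real_prod[symmetric] exp_sum[OF fJ])
  finally show ?thesis by (simp add: sum_negf sum_distrib_right)
qed

lemma borel_measurable_sum_atoms:
  assumes "B ` {..<n} \<subseteq> finite_borel_sets" and "J \<subseteq> {..<n::nat}"
  shows "(\<lambda>\<omega>. \<Sum>m\<in>J. c m * Z (B m) \<omega>) \<in> borel_measurable M"
  using assms random_variable_Z by (intro borel_measurable_sum borel_measurable_times) auto

lemma borel_measurable_simple_stable_integral:
  assumes f: "Bochner_Integration.simple_bochner_integrable lborel f"
  shows "simple_stable_integral Z f \<in> borel_measurable M"
proof -
  have [measurable]: "f \<in> borel_measurable borel"
    using f borel_measurable_simple_function[of lborel f] by (auto elim: simple_bochner_integrable.cases)
  have fin: "emeasure lborel {s. f s \<noteq> 0} \<noteq> \<infinity>" using f by (auto elim: simple_bochner_integrable.cases)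
  have "(\<lambda>\<omega>. y * Z {s. f s = y} \<omega>) \<in> borel_measurable M" for y
  proof (cases "y = 0")
    case False
    then have "emeasure lborel {s. f s = y} \<le> emeasure lborel {s. f s \<noteq> 0}"
      by (intro emeasure_mono) auto
    then have "{s. f s = y} \<in> finite_borel_sets" using fin
      by (auto simp: finite_borel_sets_def less_top top_unique)
    then show ?thesis using random_variable_Z by simp
  qed simp
  then show ?thesis unfolding simple_stable_integral_def[abs_def] by (intro borel_measurable_sum)
qed

text \<open>Linearity is hidden by the definition, as the level sets of a sum are not those of its
  summands. Over common atoms it becomes an interchange of two finite sums.\<close>

lemma simple_stable_integral_sum:
  assumes I: "finite I" and f: "\<And>i. i \<in> I \<Longrightarrow> Bochner_Integration.simple_bochner_integrable lborel (f i)"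
  shows "AE \<omega> in M. simple_stable_integral Z (\<lambda>s. \<Sum>i\<in>I. w i * f i s) \<omega> =
    (\<Sum>i\<in>I. w i * simple_stable_integral Z (f i) \<omega>)"
proof -
  obtain n :: nat and B c l where A: "disjoint_family_on B {..<n}" "B ` {..<n} \<subseteq> finite_borel_sets"
    "\<And>m. m < n \<Longrightarrow> B m \<noteq> {}" and
    fB: "\<And>i. i \<in> I \<Longrightarrow> f i = (\<lambda>s. \<Sum>m<n. c i m * indicator (B m) s)"
    by (rule common_atoms[of I f "\<lambda>_. 0"]) (rule I, erule f, rule simple_function_const, (rule that; assumption))
  have "(\<lambda>s. \<Sum>i\<in>I. w i * f i s) = (\<lambda>s. \<Sum>m<n. (\<Sum>i\<in>I. w i * c i m) * indicator (B m) s)"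
  proof
    fix s
    have "(\<Sum>i\<in>I. w i * f i s) = (\<Sum>i\<in>I. \<Sum>m<n. w i * c i m * indicator (B m) s)"
      by (rule sum.cong[OF refl]) (simp only: fB sum_distrib_left mult.assoc)
    also have "\<dots> = (\<Sum>m<n. \<Sum>i\<in>I. w i * c i m * indicator (B m) s)" by (rule sum.swap)
    finally show "(\<Sum>i\<in>I. w i * f i s) = (\<Sum>m<n. (\<Sum>i\<in>I. w i * c i m) * indicator (B m) s)"
      by (simp only: sum_distrib_right)
  qed
  from simple_stable_integral_atoms[OF A this]
  have "AE \<omega> in M. simple_stable_integral Z (\<lambda>s. \<Sum>i\<in>I. w i * f i s) \<omega> =
      (\<Sum>m<n. (\<Sum>i\<in>I. w i * c i m) * Z (B m) \<omega>)" .
  moreover have "AE \<omega> in M. \<forall>i\<in>I. simple_stable_integral Z (f i) \<omega> = (\<Sum>m<n. c i m * Z (B m) \<omega>)"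
    using I fB by (intro AE_finite_allI simple_stable_integral_atoms[OF A]) auto
  ultimately show ?thesis
  proof eventually_elim
    case (elim \<omega>)
    have "(\<Sum>i\<in>I. w i * simple_stable_integral Z (f i) \<omega>) = (\<Sum>i\<in>I. \<Sum>m<n. w i * c i m * Z (B m) \<omega>)"
      using elim(2) by (intro sum.cong[OF refl]) (simp add: sum_distrib_left mult.assoc)
    also have "\<dots> = (\<Sum>m<n. \<Sum>i\<in>I. w i * c i m * Z (B m) \<omega>)" by (rule sum.swap)
    finally show ?case using elim(1) by (simp only: sum_distrib_right)
  qed
qed

lemma char_simple_stable_integral:
  assumes f: "Bochner_Integration.simple_bochner_integrable lborel f"
  obtains a where "a \<ge> 0" "(\<integral>\<^sup>+ s. ennreal (\<bar>f s\<bar> powr \<alpha>) \<partial>lborel) = ennreal a"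
    "\<And>\<theta>. char (distr M borel (simple_stable_integral Z f)) \<theta> = of_real (exp (- (a * \<bar>\<theta>\<bar> powr \<alpha>)))"
proof -
  obtain n :: nat and B c l where A: "disjoint_family_on B {..<n}" "B ` {..<n} \<subseteq> finite_borel_sets"
    "\<And>m. m < n \<Longrightarrow> B m \<noteq> {}" and
    fB: "f = (\<lambda>s. \<Sum>m<n. c m * indicator (B m) s)"
    by (rule common_atoms[of "{()}" "\<lambda>_. f" "\<lambda>_. 0"])
      (simp, rule f, rule simple_function_const, (rule that; (assumption | simp)))
  have d: "distr M borel (simple_stable_integral Z f) = distr M borel (\<lambda>\<omega>. \<Sum>m<n. c m * Z (B m) \<omega>)"
    using A(2) by (intro distr_cong_AE simple_stable_integral_atoms[OF A fB]
        borel_measurable_simple_stable_integral[OF f] borel_measurable_sum_atoms) auto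
  show thesis
    by (rule that[of "\<Sum>m<n. \<bar>c m\<bar> powr \<alpha> * measure lborel (B m)"])
      (use nn_integral_powr_atoms[OF A(1,2)] char_sum_atoms[OF A(1,2)] in \<open>auto simp: d, auto simp: fB intro!: sum_nonneg\<close>)
qed

end

section \<open>Approximation of stable integrals in probability\<close>

lemma (in prob_space) char_tendsto_1_imp_prob_tendsto_0:
  fixes S :: "nat \<Rightarrow> 'a \<Rightarrow> real"
  assumes S: "\<And>n. S n \<in> borel_measurable M"
    and char: "\<And>\<theta>. (\<lambda>n. char (distr M borel (S n)) \<theta>) \<longlonglongrightarrow> 1" and \<delta>: "\<delta> > 0"
  shows "(\<lambda>n. prob {\<omega> \<in> space M. \<bar>S n \<omega>\<bar> > \<delta>}) \<longlonglongrightarrow> 0"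
proof -
  define R :: "real measure" where "R = return borel 0"
  have R: "real_distribution R"
    unfolding R_def real_distribution_def real_distribution_axioms_def by (auto intro: prob_space_return)
  have rd: "real_distribution (distr M borel (S n))" for n using S by simp
  have "char R \<theta> = 1" for \<theta> by (simp add: R_def char_def integral_return)
  \<comment> \<open>The limit law is the point mass at 0. Its distribution function is continuous
    except at 0, so the distribution functions converge at -\<delta> and \<delta>, and these two
    values control both tails.\<close>
  then have "weak_conv_m (\<lambda>n. distr M borel (S n)) R"
    using char by (intro levy_continuity rd R) auto
  then have wc: "(\<lambda>n. cdf (distr M borel (S n)) x) \<longlonglongrightarrow> cdf R x" if "isCont (cdf R) x" for x
    using that by (auto simp: weak_conv_m_def weak_conv_def)
  have cR: "cdf R x = (if x < 0 then 0 else 1)" for x by (simp add: cdf_def R_def measure_return indicator_def)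
  have ct: "isCont (cdf R) x" if "x \<noteq> 0" for x
  proof -
    have "\<forall>\<^sub>F y in nhds x. cdf R y = cdf R x"
    proof (cases "x < 0")
      case True
      then show ?thesis using eventually_nhds_in_open[of "{..<0}" x] by (auto simp: cR elim!: eventually_mono)
    next
      case False
      then show ?thesis using that eventually_nhds_in_open[of "{0<..}" x] by (auto simp: cR elim!: eventually_mono)
    qed
    then have "isCont (cdf R) x = isCont (\<lambda>_. cdf R x) x" by (intro isCont_cong)
    then show ?thesis by simp
  qed
  have "(\<lambda>n. cdf (distr M borel (S n)) (-\<delta>) + (1 - cdf (distr M borel (S n)) \<delta>)) \<longlonglongrightarrow> 0 + (1 - 1)"
    using wc[OF ct, of "-\<delta>"] wc[OF ct, of \<delta>] \<delta> by (intro tendsto_intros) (auto simp: cR)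
  then have lim: "(\<lambda>n. cdf (distr M borel (S n)) (-\<delta>) + (1 - cdf (distr M borel (S n)) \<delta>)) \<longlonglongrightarrow> 0" by simp
  show ?thesis
  proof (rule tendsto_sandwich[OF _ _ tendsto_const lim]; intro always_eventually allI)
    fix n
    note [measurable] = S
    have "cdf (distr M borel (S n)) x = prob {\<omega> \<in> space M. S n \<omega> \<le> x}" for x
      by (simp add: cdf_def measure_distr vimage_def Int_def conj_commute)
    moreover have "prob {\<omega> \<in> space M. \<not> S n \<omega> \<le> \<delta>} = 1 - prob {\<omega> \<in> space M. S n \<omega> \<le> \<delta>}"
      by (rule prob_neg) auto
    moreover have "prob {\<omega> \<in> space M. \<bar>S n \<omega>\<bar> > \<delta>} \<le> prob ({\<omega> \<in> space M. S n \<omega> \<le> - \<delta>} \<union> {\<omega> \<in> space M. \<not> S n \<omega> \<le> \<delta>})"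
      by (intro finite_measure_mono) auto
    moreover have "\<dots> \<le> prob {\<omega> \<in> space M. S n \<omega> \<le> - \<delta>} + prob {\<omega> \<in> space M. \<not> S n \<omega> \<le> \<delta>}"
      by (intro measure_Un_le) auto
    ultimately show "prob {\<omega> \<in> space M. \<bar>S n \<omega>\<bar> > \<delta>} \<le>
       cdf (distr M borel (S n)) (-\<delta>) + (1 - cdf (distr M borel (S n)) \<delta>)" by simp
  qed simp
qed

context sas_random_measure
begin

text \<open>The approximants supplied by \<open>has_stable_integral\<close> may be nonzero where
  \<open>f\<close> vanishes. The conditioning argument needs them to be exactly 0 from
  \<open>b\<close> on.\<close>

lemma has_stable_integral_approx:
  assumes \<alpha>: "0 < \<alpha>" and Y: "has_stable_integral M \<alpha> Z f Y" and f0: "\<And>s. b \<le> s \<Longrightarrow> f s = 0"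
  obtains F where "\<And>n. Bochner_Integration.simple_bochner_integrable lborel (F n)"
    "\<And>n s. b \<le> s \<Longrightarrow> F n s = 0"
    "(\<lambda>n. \<integral>\<^sup>+ s. ennreal (\<bar>F n s - f s\<bar> powr \<alpha>) \<partial>lborel) \<longlonglongrightarrow> 0"
    "\<And>\<delta>. \<delta> > 0 \<Longrightarrow> (\<lambda>n. prob {\<omega> \<in> space M. \<bar>simple_stable_integral Z (F n) \<omega> - Y \<omega>\<bar> > \<delta>}) \<longlonglongrightarrow> 0"
proof -
  obtain G where G: "\<And>n. Bochner_Integration.simple_bochner_integrable lborel (G n)"
    and Glim: "(\<lambda>n. \<integral>\<^sup>+ s. ennreal (\<bar>G n s - f s\<bar> powr \<alpha>) \<partial>lborel) \<longlonglongrightarrow> 0"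
    and Gp: "\<And>\<delta>. \<delta> > 0 \<Longrightarrow> (\<lambda>n. prob {\<omega> \<in> space M. \<bar>simple_stable_integral Z (G n) \<omega> - Y \<omega>\<bar> > \<delta>}) \<longlonglongrightarrow> 0"
    and [measurable]: "Y \<in> borel_measurable M"
    using Y by (auto simp: has_stable_integral_def)
  \<comment> \<open>The part of \<open>G n\<close> beyond \<open>b\<close> tends to 0 in \<open>L\<^sup>\<alpha>\<close>, so its integral tends to 0 in probability.\<close>
  define F where "F = (\<lambda>n s. G n s * indicator {..<b} s)"
  define R where "R = (\<lambda>n s. G n s * indicator {b..} s)"
  have restr: "Bochner_Integration.simple_bochner_integrable lborel (\<lambda>s. G n s * indicator A s)"
    if [measurable]: "A \<in> sets borel" for n and A :: "real set"
  proof
    have sG: "simple_function lborel (G n)" and fG: "emeasure lborel {s \<in> space lborel. G n s \<noteq> 0} \<noteq> \<infinity>"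
      using G[of n] by (auto elim: simple_bochner_integrable.cases)
    have [measurable]: "G n \<in> borel_measurable borel" using borel_measurable_simple_function[OF sG] by simp
    show "simple_function lborel (\<lambda>s. G n s * indicator A s)"
      using sG by (intro simple_function_mult simple_function_indicator) auto
    have "emeasure lborel {s \<in> space lborel. G n s * indicator A s \<noteq> 0} \<le> emeasure lborel {s \<in> space lborel. G n s \<noteq> 0}"
      by (intro emeasure_mono) auto
    then show "emeasure lborel {s \<in> space lborel. G n s * indicator A s \<noteq> 0} \<noteq> \<infinity>"
      using fG by (auto simp: top_unique)
  qed
  have F: "Bochner_Integration.simple_bochner_integrable lborel (F n)" for n unfolding F_def by (intro restr) auto
  have R: "Bochner_Integration.simple_bochner_integrable lborel (R n)" for n unfolding R_def by (intro restr) auto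
  note meas[measurable] = borel_measurable_simple_stable_integral[OF F] borel_measurable_simple_stable_integral[OF R]
    borel_measurable_simple_stable_integral[OF G]
  have "\<exists>a. \<forall>n. 0 \<le> a n \<and> (\<integral>\<^sup>+ s. ennreal (\<bar>R n s\<bar> powr \<alpha>) \<partial>lborel) = ennreal (a n) \<and>
    (\<forall>\<theta>. char (distr M borel (simple_stable_integral Z (R n))) \<theta> = of_real (exp (- (a n * \<bar>\<theta>\<bar> powr \<alpha>))))"
    by (rule choice, rule allI, rule char_simple_stable_integral[OF R]) blast
  then obtain a where a: "\<And>n. 0 \<le> a n" "\<And>n. (\<integral>\<^sup>+ s. ennreal (\<bar>R n s\<bar> powr \<alpha>) \<partial>lborel) = ennreal (a n)"
    "\<And>n \<theta>. char (distr M borel (simple_stable_integral Z (R n))) \<theta> = of_real (exp (- (a n * \<bar>\<theta>\<bar> powr \<alpha>)))"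
    by blast
  have "(\<lambda>n. ennreal (a n)) \<longlonglongrightarrow> 0"
  proof (rule tendsto_sandwich[OF _ _ tendsto_const Glim]; intro always_eventually allI)
    fix n show "ennreal (a n) \<le> (\<integral>\<^sup>+ s. ennreal (\<bar>G n s - f s\<bar> powr \<alpha>) \<partial>lborel)"
      unfolding a(2)[symmetric] R_def using f0 by (intro nn_integral_mono) (auto simp: indicator_def)
  qed simp
  then have a0: "a \<longlonglongrightarrow> 0" using a(1) by (simp add: tendsto_ennreal_iff[of _ _ 0, simplified])
  have "(\<lambda>n. char (distr M borel (simple_stable_integral Z (R n))) \<theta>) \<longlonglongrightarrow> 1" for \<theta>
  proof -
    have "(\<lambda>n. complex_of_real (exp (- (a n * \<bar>\<theta>\<bar> powr \<alpha>)))) \<longlonglongrightarrow> complex_of_real (exp (- (0 * \<bar>\<theta>\<bar> powr \<alpha>)))"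
      by (intro tendsto_intros a0)
    then show ?thesis by (simp add: a(3))
  qed
  note R0 = char_tendsto_1_imp_prob_tendsto_0[OF meas(2) this]
  have AE_eq: "AE \<omega> in M. simple_stable_integral Z (G n) \<omega> = simple_stable_integral Z (F n) \<omega> + simple_stable_integral Z (R n) \<omega>" for n
  proof -
    have "G n = (\<lambda>s. \<Sum>i\<in>UNIV. 1 * (if i then F n else R n) s)"
      by (auto simp: UNIV_bool F_def R_def fun_eq_iff indicator_def)
    then show ?thesis
      using simple_stable_integral_sum[of UNIV "\<lambda>i. if i then F n else R n" "\<lambda>_. 1"] F R
      by (auto simp: UNIV_bool add.commute)
  qed
  show thesis
  proof (rule that[OF F])
    show "F n s = 0" if "b \<le> s" for n s using that by (simp add: F_def)
    show "(\<lambda>n. \<integral>\<^sup>+ s. ennreal (\<bar>F n s - f s\<bar> powr \<alpha>) \<partial>lborel) \<longlonglongrightarrow> 0"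
    proof (rule tendsto_sandwich[OF _ _ tendsto_const Glim]; intro always_eventually allI)
      fix n show "(\<integral>\<^sup>+ s. ennreal (\<bar>F n s - f s\<bar> powr \<alpha>) \<partial>lborel) \<le> (\<integral>\<^sup>+ s. ennreal (\<bar>G n s - f s\<bar> powr \<alpha>) \<partial>lborel)"
        unfolding F_def using f0 by (intro nn_integral_mono) (auto simp: indicator_def)
    qed simp
    fix \<delta> :: real assume \<delta>: "\<delta> > 0"
    have lim: "(\<lambda>n. prob {\<omega> \<in> space M. \<bar>simple_stable_integral Z (G n) \<omega> - Y \<omega>\<bar> > \<delta>/2} +
        prob {\<omega> \<in> space M. \<bar>simple_stable_integral Z (R n) \<omega>\<bar> > \<delta>/2}) \<longlonglongrightarrow> 0"
      using tendsto_add[OF Gp R0, of "\<delta>/2" "\<delta>/2"] \<delta> by simp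
    show "(\<lambda>n. prob {\<omega> \<in> space M. \<bar>simple_stable_integral Z (F n) \<omega> - Y \<omega>\<bar> > \<delta>}) \<longlonglongrightarrow> 0"
    proof (rule tendsto_sandwich[OF _ _ tendsto_const lim]; intro always_eventually allI)
      fix n
      have "prob {\<omega> \<in> space M. \<bar>simple_stable_integral Z (F n) \<omega> - Y \<omega>\<bar> > \<delta>} \<le>
         prob ({\<omega> \<in> space M. \<bar>simple_stable_integral Z (G n) \<omega> - Y \<omega>\<bar> > \<delta>/2} \<union>
           {\<omega> \<in> space M. \<bar>simple_stable_integral Z (R n) \<omega>\<bar> > \<delta>/2})"
      proof (rule finite_measure_mono_AE)
        show "AE \<omega> in M. \<omega> \<in> {\<omega> \<in> space M. \<bar>simple_stable_integral Z (F n) \<omega> - Y \<omega>\<bar> > \<delta>} \<longrightarrow>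
          \<omega> \<in> {\<omega> \<in> space M. \<bar>simple_stable_integral Z (G n) \<omega> - Y \<omega>\<bar> > \<delta>/2} \<union>
           {\<omega> \<in> space M. \<bar>simple_stable_integral Z (R n) \<omega>\<bar> > \<delta>/2}"
          using AE_eq[of n]
        proof eventually_elim
          case (elim \<omega>)
          then have "simple_stable_integral Z (F n) \<omega> - Y \<omega> =
              (simple_stable_integral Z (G n) \<omega> - Y \<omega>) - simple_stable_integral Z (R n) \<omega>" by simp
          then have "\<bar>simple_stable_integral Z (F n) \<omega> - Y \<omega>\<bar> \<le>
              \<bar>simple_stable_integral Z (G n) \<omega> - Y \<omega>\<bar> + \<bar>simple_stable_integral Z (R n) \<omega>\<bar>"
            by (metis abs_triangle_ineq4)
          then show ?case by auto
        qed
      qed measurable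
      also have "\<dots> \<le> prob {\<omega> \<in> space M. \<bar>simple_stable_integral Z (G n) \<omega> - Y \<omega>\<bar> > \<delta>/2} +
        prob {\<omega> \<in> space M. \<bar>simple_stable_integral Z (R n) \<omega>\<bar> > \<delta>/2}"
        by (intro measure_Un_le) auto
      finally show "prob {\<omega> \<in> space M. \<bar>simple_stable_integral Z (F n) \<omega> - Y \<omega>\<bar> > \<delta>} \<le> \<dots>" .
    qed simp
  qed
qed

text \<open>The function \<open>g\<close> orders the line by levels, and \<open>f k\<close> lives on
  levels up to k. Splitting along common atoms therefore gives a triangular array, whose increment
  at k has as its scale the L^\<alpha> mass of \<open>f k\<close> on the level k alone. One
  \<open>c\<close> serves all data, which later makes the estimate uniform in j.\<close>

lemma prob_all_simple_stable_integral_le: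
  assumes \<alpha>: "1 < \<alpha>" "\<alpha> < 2"
  obtains c where "c > 0" "c \<le> 1" "\<And>K f g u B.
     (\<And>k. k < K \<Longrightarrow> Bochner_Integration.simple_bochner_integrable lborel (f k)) \<Longrightarrow>
     simple_function lborel g \<Longrightarrow> (\<And>k s. k < K \<Longrightarrow> k < g s \<Longrightarrow> f k s = 0) \<Longrightarrow>
     0 < u \<Longrightarrow> 0 < B \<Longrightarrow> B \<le> 1 \<Longrightarrow>
     (\<And>k. k < K \<Longrightarrow> ennreal (B * u powr \<alpha>) \<le>
       (\<integral>\<^sup>+ s. ennreal (\<bar>f k s * indicator {s. g s = k} s\<bar> powr \<alpha>) \<partial>lborel)) \<Longrightarrow>
     prob {\<omega> \<in> space M. \<forall>k<K. \<bar>simple_stable_integral Z (f k) \<omega>\<bar> \<le> u} \<le> (1 - c * B / 2) ^ K"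
proof -
  obtain c where c: "c > 0" "c \<le> 1" and tail: "\<And>N a u B. random_variable borel N \<Longrightarrow>
     (\<And>\<theta>. char (distr M borel N) \<theta> = of_real (exp (- (a * \<bar>\<theta>\<bar> powr \<alpha>)))) \<Longrightarrow>
     0 < u \<Longrightarrow> 0 < B \<Longrightarrow> B \<le> 1 \<Longrightarrow> B * u powr \<alpha> \<le> a \<Longrightarrow>
     c * B \<le> prob {\<omega> \<in> space M. \<bar>N \<omega>\<bar> > u}"
    using stable_tail_ge[OF \<alpha>] by blast
  have "prob {\<omega> \<in> space M. \<forall>k<K. \<bar>simple_stable_integral Z (f k) \<omega>\<bar> \<le> u} \<le> (1 - c * B / 2) ^ K"
    if f: "\<And>k. k < K \<Longrightarrow> Bochner_Integration.simple_bochner_integrable lborel (f k)"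
      and g: "simple_function lborel g" and f0: "\<And>k s. k < K \<Longrightarrow> k < g s \<Longrightarrow> f k s = 0"
      and u: "0 < u" and B: "0 < B" "B \<le> 1"
      and le: "\<And>k. k < K \<Longrightarrow> ennreal (B * u powr \<alpha>) \<le>
        (\<integral>\<^sup>+ s. ennreal (\<bar>f k s * indicator {s. g s = k} s\<bar> powr \<alpha>) \<partial>lborel)"
    for K f g u B
  proof -
    obtain n :: nat and A d l where A: "disjoint_family_on A {..<n}" "A ` {..<n} \<subseteq> finite_borel_sets"
      "\<And>m. m < n \<Longrightarrow> A m \<noteq> {}" and
      fA: "\<And>k. k < K \<Longrightarrow> f k = (\<lambda>s. \<Sum>m<n. d k m * indicator (A m) s)"
      and gA: "\<And>m s. m < n \<Longrightarrow> s \<in> A m \<Longrightarrow> g s = l m"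
      and dA: "\<And>k m s. k < K \<Longrightarrow> m < n \<Longrightarrow> s \<in> A m \<Longrightarrow> f k s = d k m"
      by (rule common_atoms[of "{..<K}" f g])
        (use f g in \<open>auto\<close>)
    define N where "N = (\<lambda>k \<omega>. \<Sum>m | m < n \<and> l m = k. d k m * Z (A m) \<omega>)"
    define a where "a = (\<lambda>k. \<Sum>m | m < n \<and> l m = k. \<bar>d k m\<bar> powr \<alpha> * measure lborel (A m))"
    have Nm[measurable]: "N k \<in> borel_measurable M" for k
      unfolding N_def by (rule borel_measurable_sum_atoms[OF A(2)]) auto
    have Nchar: "char (distr M borel (N k)) \<theta> = of_real (exp (- (a k * \<bar>\<theta>\<bar> powr \<alpha>)))" for k \<theta>
      unfolding N_def a_def by (rule char_sum_atoms[OF A(1,2)]) auto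
    have a_ge: "B * u powr \<alpha> \<le> a k" if k: "k < K" for k
    proof -
      \<comment> \<open>An atom lies either inside {g = k} or outside it, so restricting
        \<open>f k\<close> to this level keeps exactly the coefficients that occur in
        \<open>N k\<close>.\<close>
      have eq: "f k s * indicator {s. g s = k} s = (\<Sum>m<n. (if l m = k then d k m else 0) * indicator (A m) s)" for s
        unfolding fA[OF k] sum_distrib_right
        by (rule sum.cong[OF refl]) (auto simp: indicator_def gA)
      have "ennreal (B * u powr \<alpha>) \<le> ennreal (\<Sum>m<n. \<bar>if l m = k then d k m else 0\<bar> powr \<alpha> * measure lborel (A m))"
        using le[OF k] unfolding eq nn_integral_powr_atoms[OF A(1,2)] .
      also have "(\<Sum>m<n. \<bar>if l m = k then d k m else 0\<bar> powr \<alpha> * measure lborel (A m)) = a k"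
        unfolding a_def by (rule sum.mono_neutral_cong_right) auto
      finally show ?thesis by (simp add: a_def sum_nonneg)
    qed
    have sym: "prob {\<omega> \<in> space M. N k \<omega> < - u} = prob {\<omega> \<in> space M. N k \<omega> > u}" for k
    proof -
      \<comment> \<open>The characteristic function of \<open>N k\<close> is even, so
        \<open>N k\<close> and its negative have the same law.\<close>
      have "char (distr M borel (\<lambda>\<omega>. - N k \<omega>)) \<theta> = char (distr M borel (N k)) \<theta>" for \<theta>
      proof -
        have "char (distr M borel (\<lambda>\<omega>. - N k \<omega>)) \<theta> = char (distr M borel (N k)) (- \<theta>)"
          unfolding char_def by (subst (1 2) integral_distr) auto
        then show ?thesis by (simp add: Nchar)
      qed
      then have "distr M borel (\<lambda>\<omega>. - N k \<omega>) = distr M borel (N k)"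
        by (intro Levy_uniqueness real_distribution_distr) auto
      then have "measure (distr M borel (\<lambda>\<omega>. - N k \<omega>)) {u<..} = measure (distr M borel (N k)) {u<..}"
        by simp
      then have "prob ((\<lambda>\<omega>. - N k \<omega>) -` {u<..} \<inter> space M) = prob (N k -` {u<..} \<inter> space M)"
        by (simp add: measure_distr)
      moreover have "(\<lambda>\<omega>. - N k \<omega>) -` {u<..} \<inter> space M = {\<omega> \<in> space M. N k \<omega> < - u}"
        "N k -` {u<..} \<inter> space M = {\<omega> \<in> space M. N k \<omega> > u}" by auto
      ultimately show ?thesis by simp
    qed
    have "AE \<omega> in M. \<forall>k\<in>{..<K}. simple_stable_integral Z (f k) \<omega> = (\<Sum>m<n. d k m * Z (A m) \<omega>)"
      using fA by (intro AE_finite_allI simple_stable_integral_atoms[OF A]) auto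
    moreover have Tm: "(\<lambda>\<omega>. \<Sum>m<n. d k m * Z (A m) \<omega>) \<in> borel_measurable M" for k
      by (rule borel_measurable_sum_atoms[OF A(2)]) auto
    ultimately have "prob {\<omega> \<in> space M. \<forall>k<K. \<bar>simple_stable_integral Z (f k) \<omega>\<bar> \<le> u} \<le>
        prob {\<omega> \<in> space M. \<forall>k<K. \<bar>\<Sum>m<n. d k m * Z (A m) \<omega>\<bar> \<le> u}"
      by (intro finite_measure_mono_AE) (auto elim!: eventually_mono)
    also have "\<dots> \<le> (\<Prod>k<K. 1 - prob {\<omega> \<in> space M. \<bar>\<Sum>m | m < n \<and> l m = k. d k m * Z (A m) \<omega>\<bar> > u} / 2)"
    proof (rule prob_all_abs_le_prod[OF indep_Z[OF A(1,2)]])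
      \<comment> \<open>Any point of the nonempty atom \<open>A m\<close> has level
        \<open>l m\<close> > k, and there \<open>f k\<close>, whose value is \<open>d k m\<close>,
        vanishes.\<close>
      show "d k m = 0" if "k < K" "m < n" "k < l m" for k m
        using A(3)[OF that(2)] gA[OF that(2)] dA[OF that(1,2)] f0[OF that(1)] that(3) by fastforce
      show "prob {\<omega> \<in> space M. (\<Sum>m | m < n \<and> l m = k. d k m * Z (A m) \<omega>) < - u} =
        prob {\<omega> \<in> space M. (\<Sum>m | m < n \<and> l m = k. d k m * Z (A m) \<omega>) > u}" for k
        using sym[of k] by (simp add: N_def)
    qed (use u in auto)
    also have "\<dots> \<le> (\<Prod>k<K. 1 - c * B / 2)"
    proof (rule prod_mono, intro conjI)
      fix k assume "k \<in> {..<K}"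
      then have "c * B \<le> prob {\<omega> \<in> space M. \<bar>N k \<omega>\<bar> > u}"
        using tail[OF Nm Nchar u B a_ge] by simp
      then show "1 - prob {\<omega> \<in> space M. \<bar>\<Sum>m | m < n \<and> l m = k. d k m * Z (A m) \<omega>\<bar> > u} / 2 \<le> 1 - c * B / 2"
        by (simp add: N_def)
      have "prob {\<omega> \<in> space M. \<bar>N k \<omega>\<bar> > u} \<le> 1" by simp
      then show "0 \<le> 1 - prob {\<omega> \<in> space M. \<bar>\<Sum>m | m < n \<and> l m = k. d k m * Z (A m) \<omega>\<bar> > u} / 2"
        unfolding N_def by linarith
    qed
    finally show ?thesis by simp
  qed
  with c show thesis by (rule that)
qed

end

section \<open>Bounded test functions and L^\<alpha> mass\<close>

lemma abs_le_add_powr: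
  fixes x \<eta> \<alpha> :: real
  assumes "\<alpha> > 1" "\<eta> > 0" "x \<ge> 0"
  shows "x \<le> \<eta> + \<eta> powr (1 - \<alpha>) * x powr \<alpha>"
proof (cases "x \<le> \<eta>")
  case False
  then have "x = x powr (1 - \<alpha>) * x powr \<alpha>" using assms by (simp flip: powr_add)
  also have "\<dots> \<le> \<eta> powr (1 - \<alpha>) * x powr \<alpha>"
    using False assms by (intro mult_right_mono powr_mono2') auto
  finally show ?thesis using assms by linarith
qed (use assms in \<open>simp add: add_increasing2\<close>)

text \<open>\<open>abs_le_add_powr\<close> takes the place of Hoelder's inequality: the integral of
  |F n - f| over \<open>D\<close> is at most \<eta> d plus \<eta>^{1-\<alpha>} times the L^\<alpha>
  error. Once that error is below \<eta>^\<alpha>, the total is at most \<eta> (d + 1), and \<eta>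
  is chosen to make this e / 2.\<close>

lemma tendsto_integral_of_powr_convergence:
  fixes f h :: "real \<Rightarrow> real" and F :: "nat \<Rightarrow> real \<Rightarrow> real"
  assumes \<alpha>: "\<alpha> > 1" and F[measurable]: "\<And>n. F n \<in> borel_measurable borel" and f[measurable]: "f \<in> borel_measurable borel"
    and D[measurable]: "D \<in> sets borel" and Dfin: "emeasure lborel D < \<infinity>"
    and h[measurable]: "h \<in> borel_measurable borel" and hD: "\<And>s. \<bar>h s\<bar> \<le> indicator D s"
    and Fi: "\<And>n. integrable lborel (\<lambda>s. F n s * h s)" and fi: "integrable lborel (\<lambda>s. f s * h s)"
    and lim: "(\<lambda>n. \<integral>\<^sup>+ s. ennreal (\<bar>F n s - f s\<bar> powr \<alpha>) \<partial>lborel) \<longlonglongrightarrow> 0"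
  shows "(\<lambda>n. LINT s|lborel. F n s * h s) \<longlonglongrightarrow> (LINT s|lborel. f s * h s)"
proof (rule tendstoI)
  fix e :: real assume e: "e > 0"
  define d where "d = measure lborel D"
  define \<eta> where "\<eta> = (e / 2) / (d + 1)"
  have d: "d \<ge> 0" by (simp add: d_def)
  have \<eta>: "\<eta> > 0" using e d by (simp add: \<eta>_def)
  have "\<forall>\<^sub>F n in sequentially. (\<integral>\<^sup>+ s. ennreal (\<bar>F n s - f s\<bar> powr \<alpha>) \<partial>lborel) < ennreal (\<eta> powr \<alpha>)"
    using order_tendstoD(2)[OF lim, of "ennreal (\<eta> powr \<alpha>)"] \<eta> by simp
  then show "\<forall>\<^sub>F n in sequentially. dist (LINT s|lborel. F n s * h s) (LINT s|lborel. f s * h s) < e"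
  proof eventually_elim
    case (elim n)
    have "dist (LINT s|lborel. F n s * h s) (LINT s|lborel. f s * h s) = norm (LINT s|lborel. F n s * h s - f s * h s)"
      using Fi fi by (simp add: dist_norm)
    also have "ennreal \<dots> \<le> (\<integral>\<^sup>+ s. ennreal (norm (F n s * h s - f s * h s)) \<partial>lborel)"
      using Fi fi by (intro integral_norm_bound_ennreal) auto
    also have "\<dots> \<le> (\<integral>\<^sup>+ s. ennreal \<eta> * indicator D s + ennreal (\<eta> powr (1 - \<alpha>)) * ennreal (\<bar>F n s - f s\<bar> powr \<alpha>) \<partial>lborel)"
    proof (rule nn_integral_mono)
      fix s
      have "norm (F n s * h s - f s * h s) = \<bar>F n s - f s\<bar> * \<bar>h s\<bar>" by (simp add: left_diff_distrib flip: abs_mult)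
      also have "\<dots> \<le> \<bar>F n s - f s\<bar> * indicator D s" using hD by (intro mult_left_mono) auto
      also have "\<dots> \<le> (\<eta> + \<eta> powr (1 - \<alpha>) * \<bar>F n s - f s\<bar> powr \<alpha>) * indicator D s"
        using \<alpha> \<eta> by (intro mult_right_mono abs_le_add_powr) auto
      also have "\<dots> \<le> \<eta> * indicator D s + \<eta> powr (1 - \<alpha>) * \<bar>F n s - f s\<bar> powr \<alpha>"
        by (auto simp: indicator_def)
      finally show "ennreal (norm (F n s * h s - f s * h s)) \<le>
         ennreal \<eta> * indicator D s + ennreal (\<eta> powr (1 - \<alpha>)) * ennreal (\<bar>F n s - f s\<bar> powr \<alpha>)"
        using \<eta> by (simp add: ennreal_leI flip: ennreal_mult ennreal_plus ennreal_indicator)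
    qed
    also have "\<dots> = ennreal \<eta> * emeasure lborel D +
       ennreal (\<eta> powr (1 - \<alpha>)) * (\<integral>\<^sup>+ s. ennreal (\<bar>F n s - f s\<bar> powr \<alpha>) \<partial>lborel)"
      by (subst nn_integral_add) (auto simp: nn_integral_cmult nn_integral_cmult_indicator)
    also have "\<dots> \<le> ennreal \<eta> * ennreal d + ennreal (\<eta> powr (1 - \<alpha>)) * ennreal (\<eta> powr \<alpha>)"
      using elim Dfin by (intro add_mono mult_left_mono) (auto simp: d_def emeasure_eq_ennreal_measure)
    also have "\<dots> = ennreal (\<eta> * d + \<eta>)"
      using \<eta> d by (simp flip: ennreal_mult ennreal_plus powr_add)
    finally have "dist (LINT s|lborel. F n s * h s) (LINT s|lborel. f s * h s) \<le> \<eta> * d + \<eta>"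
      using \<eta> d by (simp add: ennreal_le_iff del: ennreal_plus)
    also have "\<dots> = (d + 1) * \<eta>" by (simp add: algebra_simps)
    also have "\<dots> = e / 2"
    proof -
      have "d + 1 \<noteq> 0" using d by simp
      then show ?thesis unfolding \<eta>_def by (rule nonzero_mult_div_cancel_left[of "d + 1" "e / 2", folded times_divide_eq_right])
    qed
    also have "\<dots> < e" using e by simp
    finally show ?case .
  qed
qed

text \<open>Off a large set, |f| exceeds y only at the price of L^\<alpha> mass: the integral of |f
  h| is at most y d + y^{1-\<alpha>} times the mass on \<open>D\<close>. As the tested integral is
  at least 2 y d, the second term has to supply y d.\<close>

lemma nn_integral_powr_ge:
  fixes f h :: "real \<Rightarrow> real"
  assumes \<alpha>: "\<alpha> > 1" and f[measurable]: "f \<in> borel_measurable borel" and D[measurable]: "D \<in> sets borel"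
    and Dm: "emeasure lborel D = ennreal d" and d: "d > 0"
    and h[measurable]: "h \<in> borel_measurable borel" and hD: "\<And>s. \<bar>h s\<bar> \<le> indicator D s"
    and fi: "integrable lborel (\<lambda>s. f s * h s)" and y: "y > 0"
    and ge: "2 * y * d \<le> \<bar>LINT s|lborel. f s * h s\<bar>"
  shows "ennreal (d * y powr \<alpha>) \<le> (\<integral>\<^sup>+ s. ennreal (\<bar>f s * indicator D s\<bar> powr \<alpha>) \<partial>lborel)"
proof -
  have pw: "\<bar>f s\<bar> * \<bar>h s\<bar> \<le> y * indicator D s + y powr (1 - \<alpha>) * \<bar>f s * indicator D s\<bar> powr \<alpha>" for s
  proof -
    have "\<bar>f s\<bar> * \<bar>h s\<bar> \<le> \<bar>f s\<bar> * indicator D s" using hD by (intro mult_left_mono) auto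
    also have "\<dots> \<le> (y + y powr (1 - \<alpha>) * \<bar>f s\<bar> powr \<alpha>) * indicator D s"
      using \<alpha> y by (intro mult_right_mono abs_le_add_powr) auto
    finally show ?thesis by (auto simp: indicator_def)
  qed
  have "ennreal (2 * y * d) \<le> ennreal (norm (LINT s|lborel. f s * h s))" using ge by (intro ennreal_leI) simp
  also have "\<dots> \<le> (\<integral>\<^sup>+ s. ennreal (norm (f s * h s)) \<partial>lborel)" using fi by (rule integral_norm_bound_ennreal)
  also have "\<dots> \<le> (\<integral>\<^sup>+ s. ennreal y * indicator D s + ennreal (y powr (1 - \<alpha>)) * ennreal (\<bar>f s * indicator D s\<bar> powr \<alpha>) \<partial>lborel)"
    using y pw by (intro nn_integral_mono)
      (simp add: abs_mult ennreal_leI flip: ennreal_mult ennreal_plus ennreal_indicator)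
  also have "\<dots> = ennreal y * emeasure lborel D +
       ennreal (y powr (1 - \<alpha>)) * (\<integral>\<^sup>+ s. ennreal (\<bar>f s * indicator D s\<bar> powr \<alpha>) \<partial>lborel)"
    by (subst nn_integral_add) (auto simp: nn_integral_cmult nn_integral_cmult_indicator)
  finally have *: "ennreal (2 * y * d) \<le> ennreal (y * d) +
     ennreal (y powr (1 - \<alpha>)) * (\<integral>\<^sup>+ s. ennreal (\<bar>f s * indicator D s\<bar> powr \<alpha>) \<partial>lborel)" (is "_ \<le> _ + _ * ?J")
    using y d by (simp add: Dm flip: ennreal_mult)
  show ?thesis
  proof (cases "?J")
    case (real r)
    have "2 * y * d \<le> y * d + y powr (1 - \<alpha>) * r"
      using * real y d by (simp flip: ennreal_mult ennreal_plus)
    then have "y * d \<le> y powr (1 - \<alpha>) * r" by (simp add: mult.commute)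
    then have "y powr (\<alpha> - 1) * (y * d) \<le> y powr (\<alpha> - 1) * (y powr (1 - \<alpha>) * r)" by (intro mult_left_mono) auto
    then have "y powr \<alpha> * d \<le> r" using y by (simp add: powr_diff mult.assoc[symmetric] flip: powr_add)
    then have "d * y powr \<alpha> \<le> r" by (simp add: mult.commute)
    then show ?thesis unfolding real by (intro ennreal_leI)
  qed simp
qed

section \<open>Riemann sums and moments of the wavelet\<close>

lemma riemann_sum_tendsto_integral:
  fixes g :: "real \<Rightarrow> real"
  assumes g: "continuous_on {0..1} g"
  shows "(\<lambda>n. \<Sum>i<n. g (real i / real n) / real n) \<longlonglongrightarrow> (LINT y|lborel. indicator {0..1} y * g y)"
proof -
  \<comment> \<open>An antiderivative turns the integral into a telescoping sum, which is compared
    with the Riemann sum on each subinterval by the mean value theorem.\<close>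
  obtain G where G: "\<And>x. x \<in> {0..1} \<Longrightarrow> (G has_vector_derivative g x) (at x within {0..1})"
    using antiderivative_continuous[OF g] by blast
  have "has_bochner_integral lborel (\<lambda>x. indicator {0..1} x *\<^sub>R g x) (G 1 - G 0)"
    using G g by (intro has_bochner_integral_FTC_Icc) auto
  then have int: "(LINT y|lborel. indicator {0..1} y * g y) = G 1 - G 0"
    by (simp add: has_bochner_integral_iff)
  show ?thesis unfolding int
  proof (rule tendstoI)
    fix e :: real assume e: "e > 0"
    have "uniformly_continuous_on {0..1} g" using g by (intro compact_uniformly_continuous) auto
    then obtain d where d: "d > 0" "\<And>x y. x \<in> {0..1} \<Longrightarrow> y \<in> {0..1} \<Longrightarrow> dist y x < d \<Longrightarrow> dist (g y) (g x) < e / 2"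
      using e unfolding uniformly_continuous_on_def by (meson half_gt_zero)
    have "\<forall>\<^sub>F n in sequentially. 1 / real n < d" using order_tendstoD(2)[OF lim_1_over_n[where 'a=real]] d by simp
    then show "\<forall>\<^sub>F n in sequentially. dist (\<Sum>i<n. g (real i / real n) / real n) (G 1 - G 0) < e"
      using eventually_gt_at_top[of 0]
    proof eventually_elim
      case (elim n)
      then have n: "n > 0" by simp
      have tel: "G 1 - G 0 = (\<Sum>i<n. G (real (Suc i) / n) - G (real i / n))"
        using n sum_lessThan_telescope[of "\<lambda>i. G (real i / n)" n] by simp
      have "\<bar>g (real i / n) / n - (G (real (Suc i) / n) - G (real i / n))\<bar> \<le> e / 2 / n" if i: "i < n" for i
      proof -
        have le: "real i / n \<le> real (Suc i) / n" using n by (simp add: divide_right_mono)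
        have sub: "{real i / n..real (Suc i) / n} \<subseteq> {0..1}" using i n by (auto intro: order_trans)
        have "\<exists>x\<in>{real i / n..real (Suc i) / n}. G (real (Suc i) / n) - G (real i / n) = (real (Suc i) / n - real i / n) * g x"
        proof (rule mvt_very_simple[OF le])
          fix x assume "real i / n \<le> x" "x \<le> real (Suc i) / n"
          then have x: "x \<in> {real i / n..real (Suc i) / n}" by simp
          have "(G has_vector_derivative g x) (at x within {real i / n..real (Suc i) / n})"
            using has_vector_derivative_within_subset[OF G sub] x sub by blast
          then show "(G has_derivative (\<lambda>z. z * g x)) (at x within {real i / n..real (Suc i) / n})"
            by (simp add: has_vector_derivative_def)
        qed
        then obtain x where x: "x \<in> {real i / n..real (Suc i) / n}"
          "G (real (Suc i) / n) - G (real i / n) = (real (Suc i) / n - real i / n) * g x" by blast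
        have "(real (Suc i) / n - real i / n) = 1 / n" by (simp add: diff_divide_distrib[symmetric])
        then have eq: "g (real i / n) / n - (G (real (Suc i) / n) - G (real i / n)) = (g (real i / n) - g x) / n"
          using x(2) by (simp add: diff_divide_distrib)
        have "dist (real i / n) x \<le> real (Suc i) / n - real i / n" using x(1) by (auto simp: dist_real_def)
        then have "dist (real i / n) x < d" using elim(1) by (simp add: diff_divide_distrib[symmetric])
        moreover have "real i / n \<in> {real i / n..real (Suc i) / n}" using le by simp
        ultimately have "dist (g (real i / n)) (g x) < e / 2" using d(2) x(1) sub by blast
        then have "\<bar>g (real i / n) - g x\<bar> \<le> e / 2" by (simp add: dist_real_def)
        from divide_right_mono[OF this, of "real n"] show ?thesis unfolding eq by simp
      qed
      then have "\<bar>\<Sum>i<n. g (real i / n) / n - (G (real (Suc i) / n) - G (real i / n))\<bar> \<le> (\<Sum>i<n. e / 2 / n)"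
        by (intro order_trans[OF sum_abs] sum_mono) auto
      also have "\<dots> = e / 2" using n by simp
      finally show ?case unfolding tel using e by (simp add: dist_real_def sum_subtractf)
    qed
  qed
qed

text \<open>The factor y^a is absorbed into g(y) = \<psi>(y) y^a. If all moments vanished, g would
  be orthogonal to every polynomial on [0,1], hence to uniform limits of polynomials and so to
  itself.\<close>

lemma exists_nonzero_moment:
  fixes \<psi> :: "real \<Rightarrow> real" and a :: real
  assumes \<psi>: "continuous_on UNIV \<psi>" and nz: "\<exists>s. \<psi> s \<noteq> 0" and supp: "closure {s. \<psi> s \<noteq> 0} \<subseteq> {0..1}"
    and a: "a > 0"
  shows "\<exists>p::nat. (LINT y|lborel. indicator {0..1} y * (\<psi> y * y powr (a + p))) \<noteq> 0"
proof (rule ccontr)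
  assume "\<not> ?thesis"
  then have zero: "(LINT y|lborel. indicator {0..1} y * (\<psi> y * y powr (a + p))) = 0" for p :: nat by auto
  define g where "g = (\<lambda>y. \<psi> y * y powr a)"
  have pc: "continuous_on {0..1} (\<lambda>y::real. y powr a)"
    using a by (intro continuous_on_powr' continuous_intros) auto
  have gc: "continuous_on {0..1} g" unfolding g_def
    using continuous_on_subset[OF \<psi>] pc by (intro continuous_on_mult) auto
  have int: "integrable lborel (\<lambda>y. indicator {0..1} y * u y)" if "continuous_on {0..1} u" for u :: "real \<Rightarrow> real"
    using borel_integrable_atLeastAtMost'[OF that] by (simp add: set_integrable_def)
  have zero': "(LINT y|lborel. indicator {0..1} y * (g y * y ^ p)) = 0" for p :: nat
  proof -
    have eq: "indicator {0..1} y * (g y * y ^ p) = indicator {0..1} y * (\<psi> y * y powr (a + p))" for y :: real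
      using a by (cases "y = 0") (auto simp: g_def powr_add powr_realpow indicator_def)
    show ?thesis by (simp only: eq zero)
  qed
  have zerop: "(LINT y|lborel. indicator {0..1} y * (g y * q y)) = 0" if q: "real_polynomial_function q" for q
  proof -
    obtain c and n :: nat where qc: "q = (\<lambda>x. \<Sum>i\<le>n. c i * x ^ i)"
      using q unfolding real_polynomial_function_iff_sum by blast
    have "(LINT y|lborel. indicator {0..1} y * (g y * q y)) = (LINT y|lborel. (\<Sum>i\<le>n. c i * (indicator {0..1} y * (g y * y ^ i))))"
      by (simp add: qc sum_distrib_left mult_ac)
    also have "\<dots> = (\<Sum>i\<le>n. LINT y|lborel. c i * (indicator {0..1} y * (g y * y ^ i)))"
      by (intro Bochner_Integration.integral_sum integrable_mult_right int continuous_on_mult gc continuous_intros)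
    also have "\<dots> = 0" by (simp add: zero')
    finally show ?thesis .
  qed
  have "bounded (g ` {0..1})"
    by (intro compact_imp_bounded compact_continuous_image[OF gc]) simp
  then obtain b where "\<forall>x\<in>g ` {0..1}. norm x \<le> b"
    unfolding bounded_iff by blast
  then have b: "\<bar>g y\<bar> \<le> b" if "y \<in> {0..1}" for y using that by auto
  define b' where "b' = \<bar>b\<bar> + 1"
  have b': "b' > 0" "\<And>y. y \<in> {0..1} \<Longrightarrow> \<bar>g y\<bar> \<le> b'" using b by (force simp: b'_def)+
  define Q where "Q = (LINT y|lborel. indicator {0..1} y * (g y * g y))"
  have Q0: "Q \<ge> 0" unfolding Q_def by (intro integral_nonneg_AE) auto
  \<comment> \<open>With a polynomial q within e / b' of g, orthogonality lets Q be written as the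
    integral of g (g - q), which is at most e.\<close>
  have Qe: "Q \<le> e" if e: "e > 0" for e
  proof -
    have "\<exists>q. polynomial_function q \<and> (\<forall>x\<in>{0..1}. norm (g x - q x) < e / b')"
      using Stone_Weierstrass_polynomial_function[of "{0..1}" g "e / b'"] gc e b' by auto
    then obtain q where q: "real_polynomial_function q" "\<And>x. x \<in> {0..1} \<Longrightarrow> \<bar>g x - q x\<bar> < e / b'"
      by (auto simp: real_polynomial_function_eq)
    have qc: "continuous_on {0..1} q" using q(1) continuous_on_polymonial_function real_polynomial_function_eq by blast
    have "Q = Q - (LINT y|lborel. indicator {0..1} y * (g y * q y))" using zerop[OF q(1)] by simp
    also have "\<dots> = (LINT y|lborel. indicator {0..1} y * (g y * g y) - indicator {0..1} y * (g y * q y))"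
      unfolding Q_def by (intro Bochner_Integration.integral_diff[symmetric] int continuous_on_mult gc qc)
    also have "\<dots> \<le> (LINT y|lborel. indicator {0..1::real} y * e)"
    proof (rule integral_mono)
      fix y :: real
      have "g y * g y - g y * q y \<le> e" if y: "y \<in> {0..1}"
      proof -
        have "g y * g y - g y * q y \<le> \<bar>g y\<bar> * \<bar>g y - q y\<bar>"
          by (metis abs_ge_self abs_mult right_diff_distrib)
        also have "\<dots> \<le> b' * (e / b')" using b' y q(2)[OF y] by (intro mult_mono) auto
        finally show ?thesis using b' by simp
      qed
      then show "indicator {0..1} y * (g y * g y) - indicator {0..1} y * (g y * q y) \<le> indicator {0..1} y * e"
        by (auto simp: indicator_def)
    qed (intro Bochner_Integration.integrable_diff int continuous_on_mult gc qc continuous_intros)+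
    also have "\<dots> = e" by simp
    finally show ?thesis .
  qed
  have "Q \<le> 0" by (rule field_le_epsilon) (simp add: Qe)
  then have Qz: "Q = 0" using Q0 by linarith
  have "AE y in lborel. indicator {0..1} y * (g y * g y) = 0"
    using Qz unfolding Q_def by (subst (asm) integral_nonneg_eq_0_iff_AE) (auto intro!: int continuous_on_mult gc)
  then have "AE y in lborel. y \<in> {0<..<1} \<longrightarrow> \<psi> y = 0"
    by eventually_elim (auto simp: g_def)
  obtain s where s: "\<psi> s \<noteq> 0" using nz by blast
  have "open {s. \<psi> s \<noteq> 0}" using \<psi> by (intro open_Collect_neq) auto
  \<comment> \<open>Vanishing almost everywhere is known only on (0,1), because the weight y^a kills
    the left endpoint. The open set where \<psi> is nonzero lies in this interior, and a nonempty
    open set is not null.\<close>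
  then have op: "{s. \<psi> s \<noteq> 0} \<subseteq> interior {0..1}" 
    by (rule interior_maximal[OF order_trans[OF closure_subset supp]])
  let ?U = "{s. \<psi> s \<noteq> 0}"
  have "AE y in lborel. y \<notin> ?U" using \<open>AE y in lborel. y \<in> {0<..<1} \<longrightarrow> \<psi> y = 0\<close> op
    by (auto elim!: eventually_mono)
  then have "emeasure lborel ?U = 0"
    using \<open>open ?U\<close> by (subst (asm) AE_iff_measurable[OF _ refl]) auto
  moreover have "negligible ?U \<Longrightarrow> False"
    using open_not_negligible[OF \<open>open ?U\<close>] s by blast
  ultimately show False
    using \<open>open ?U\<close> by (simp add: negligible_iff_null_sets null_sets_def emeasure_completion)
qed

subsection \<open>Testing the kernel on a dyadic cell\<close>

lemma lborel_integral_cell: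
  fixes f :: "real \<Rightarrow> real"
  shows "(LINT s|lborel. f s) = 1 / 2 ^ j * (LINT x|lborel. f ((x + real k) / 2 ^ j))"
  using lborel_integral_real_affine[of "1 / 2 ^ j" f "real k / 2 ^ j"] by (simp add: add_divide_distrib add.commute)

text \<open>This is x^p on [0,1) carried to a dyadic cell by s = (x + k) / 2^j. The cell is
  half-open to agree with the floor function that later defines the levels.\<close>

definition cell_weight :: "nat \<Rightarrow> nat \<Rightarrow> nat \<Rightarrow> real \<Rightarrow> real" where
  "cell_weight p j k s = indicator {real k / 2 ^ j ..< real (k + 1) / 2 ^ j} s * (2 ^ j * s - real k) ^ p"

lemma cell_weight_measurable [measurable]: "cell_weight p j k \<in> borel_measurable borel"
  unfolding cell_weight_def by measurable

lemma cell_weight_rescale: "cell_weight p j k ((x + real k) / 2 ^ j) = indicator {0..<1} x * x ^ p"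
  by (auto simp: cell_weight_def indicator_def field_simps)

lemma abs_cell_weight_le: "\<bar>cell_weight p j k s\<bar> \<le> indicator {real k / 2 ^ j ..< real (k + 1) / 2 ^ j} s"
proof -
  define x where "x = 2 ^ j * s - real k"
  have s: "s = (x + real k) / 2 ^ j" by (simp add: x_def)
  show ?thesis unfolding s cell_weight_rescale
    by (auto simp: indicator_def abs_mult power_abs field_simps intro!: power_le_one)
qed

text \<open>Substituting y x for x reduces every y to y = 1: the kernel contributes y^\<kappa>, the
  weight y^p and the measure y. The constant is the Beta integral of (1 - x)^\<kappa> x^p over
  [0,1].\<close>

lemma exists_kernel_moment_constant:
  fixes \<kappa> :: real
  assumes \<kappa>: "\<kappa> > 0"
  shows "\<exists>c>0. \<forall>y\<in>{0..1}. (LINT x|lborel. max (y - x) 0 powr \<kappa> * (indicator {0..<1} x * x ^ p)) = c * y powr (\<kappa> + 1 + real p)"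
proof -
  define c where "c = (LINT x|lborel. max (1 - x) 0 powr \<kappa> * (indicator {0..<1} x * x ^ p))"
  have meas: "(\<lambda>x::real. max (1 - x) 0 powr \<kappa> * (indicator {0..<1} x * x ^ p)) \<in> borel_measurable lborel" by measurable
  have int: "integrable lborel (\<lambda>x::real. max (1 - x) 0 powr \<kappa> * (indicator {0..<1} x * x ^ p))"
  proof (rule Bochner_Integration.integrable_bound[OF _ meas])
    show "integrable lborel (indicator {0..<1} :: real \<Rightarrow> real)" by simp
    show "AE x in lborel. norm (max (1 - x) 0 powr \<kappa> * (indicator {0..<1} x * x ^ p)) \<le> norm (indicator {0..<1} x :: real)"
      using \<kappa> by (intro AE_I2) (auto simp: indicator_def abs_mult power_abs intro!: mult_le_one powr_le1 power_le_one)
  qed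
  \<comment> \<open>On [1/4, 1/2], an interval of length 1/4, both 1 - x \<ge> 1/2 and x \<ge> 1/4
    hold.\<close>
  have "0 < (1/2::real) powr \<kappa> * (1/4) ^ p * (1/4)" by simp
  also have "\<dots> = (LINT x|lborel. (1/2::real) powr \<kappa> * (1/4) ^ p * indicator {1/4..1/2::real} x)"
    by simp
  also have "\<dots> \<le> c" unfolding c_def
  proof (rule integral_mono[OF _ int])
    fix x :: real
    show "(1/2::real) powr \<kappa> * (1/4) ^ p * indicator {1/4..1/2} x \<le> max (1 - x) 0 powr \<kappa> * (indicator {0..<1} x * x ^ p)"
      using \<kappa> by (auto simp: indicator_def intro!: mult_mono powr_mono2 power_mono)
  qed simp
  finally have c: "c > 0" .
  have "(LINT x|lborel. max (y - x) 0 powr \<kappa> * (indicator {0..<1} x * x ^ p)) = c * y powr (\<kappa> + 1 + real p)"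
    if y: "y \<in> {0..1}" for y
  proof (cases "y = 0")
    case True
    have eq: "max (0 - x) 0 powr \<kappa> * (indicator {0..<1} x * x ^ p) = 0" for x :: real by (auto simp: indicator_def)
    show ?thesis unfolding True by (simp only: eq) simp
  next
    case False
    then have y0: "y > 0" "y \<le> 1" using y by auto
    have "(LINT x|lborel. max (y - x) 0 powr \<kappa> * (indicator {0..<1} x * x ^ p)) =
       y * (LINT x|lborel. max (y - y * x) 0 powr \<kappa> * (indicator {0..<1} (y * x) * (y * x) ^ p))"
      using lborel_integral_real_affine[of y "\<lambda>x. max (y - x) 0 powr \<kappa> * (indicator {0..<1} x * x ^ p)" 0] y0 by simp
    also have "(\<lambda>x. max (y - y * x) 0 powr \<kappa> * (indicator {0..<1} (y * x) * (y * x) ^ p)) =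
      (\<lambda>x. y powr (\<kappa> + real p) * (max (1 - x) 0 powr \<kappa> * (indicator {0..<1} x * x ^ p)))"
    proof
      fix x :: real
      have "max (y - y * x) 0 = y * max (1 - x) 0" using y0
        by (simp add: max_mult_distrib_left right_diff_distrib)
      \<comment> \<open>After the substitution the weight lives on [0, 1/y) instead of [0,1). The
        two differ only at x \<ge> 1, where the kernel is 0.\<close>
      moreover have "indicator {0..<1} (y * x) = (indicator {0..<1} x :: real)" if "x < 1"
      proof -
        have "y * x < 1"
        proof (cases "0 \<le> x")
          case True
          then have "y * x \<le> 1 * x" using y0 by (intro mult_right_mono) auto
          then show ?thesis using that by simp
        qed (use y0 mult_pos_neg[of y x] in linarith)
        then show ?thesis using that y0 by (auto simp: indicator_def zero_le_mult_iff)
      qed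
      ultimately show "max (y - y * x) 0 powr \<kappa> * (indicator {0..<1} (y * x) * (y * x) ^ p) =
        y powr (\<kappa> + real p) * (max (1 - x) 0 powr \<kappa> * (indicator {0..<1} x * x ^ p))"
        using y0 by (cases "x < 1") (auto simp: powr_mult powr_add powr_realpow power_mult_distrib)
    qed
    also have "y * (LINT x|lborel. y powr (\<kappa> + real p) * (max (1 - x) 0 powr \<kappa> * (indicator {0..<1} x * x ^ p))) =
      c * y powr (\<kappa> + 1 + real p)"
      using y0 by (simp add: c_def powr_add)
    finally show ?thesis .
  qed
  then show ?thesis using c by blast
qed

lemma integral_lfsm_kernel_cell_weight:
  assumes y: "y \<in> {0..1}"
  shows "(LINT s|lborel. lfsm_kernel H \<alpha> ((y + real k) / 2 ^ j) s * cell_weight p j k s) =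
    1 / 2 ^ j * (2 powr (- real j * (H - 1 / \<alpha>)) *
      (LINT x|lborel. max (y - x) 0 powr (H - 1 / \<alpha>) * (indicator {0..<1} x * x ^ p)))"
proof -
  have "lfsm_kernel H \<alpha> ((y + real k) / 2 ^ j) ((x + real k) / 2 ^ j) * cell_weight p j k ((x + real k) / 2 ^ j) =
     2 powr (- real j * (H - 1 / \<alpha>)) * (max (y - x) 0 powr (H - 1 / \<alpha>) * (indicator {0..<1} x * x ^ p))" for x
  proof (cases "x \<in> {0..<1}")
    case True
    \<comment> \<open>The cell lies in the nonnegative half-line, so the second term of the kernel
      is a power of 0, which is 0. What remains is homogeneous and rescales by 2^{-j
      \<kappa>}.\<close>
    then have "max (- ((x + real k) / 2 ^ j)) 0 = 0" by simp
    moreover have "max ((y + real k) / 2 ^ j - (x + real k) / 2 ^ j) 0 = max (y - x) 0 * 2 powr (- real j)"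
      by (simp add: diff_divide_distrib[symmetric] powr_minus_divide powr_realpow max_def divide_simps)
    ultimately have "lfsm_kernel H \<alpha> ((y + real k) / 2 ^ j) ((x + real k) / 2 ^ j) =
       2 powr (- real j * (H - 1 / \<alpha>)) * max (y - x) 0 powr (H - 1 / \<alpha>)"
      unfolding lfsm_kernel_def by (simp add: powr_mult powr_powr)
    then show ?thesis by (simp add: cell_weight_rescale)
  qed (simp add: cell_weight_rescale)
  then show ?thesis by (subst lborel_integral_cell[of _ j k]) simp
qed

subsection \<open>Wavelet coefficients\<close>

lemma simple_bochner_integrable_sum:
  fixes f :: "'i \<Rightarrow> 'a \<Rightarrow> real"
  assumes "finite I" and f: "\<And>i. i \<in> I \<Longrightarrow> Bochner_Integration.simple_bochner_integrable M (f i)"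
  shows "Bochner_Integration.simple_bochner_integrable M (\<lambda>s. \<Sum>i\<in>I. w i * f i s)"
  using assms
proof (induction I rule: finite_induct)
  case empty
  show ?case by (auto intro: simple_bochner_integrable.intros)
next
  case (insert i I)
  have "Bochner_Integration.simple_bochner_integrable M (\<lambda>s. w i * f i s + (\<Sum>i\<in>I. w i * f i s))"
    by (rule simple_bochner_integrable_compose2[of "\<lambda>x y. w i * x + y"]) (use insert in auto)
  then show ?case using insert by simp
qed

lemma wavelet_coeff_eq_integral_unit_interval:
  assumes "closure {s. \<psi> s \<noteq> 0} \<subseteq> {0..1}"
  shows "wavelet_coeff \<psi> x j k = (LINT y|lborel. indicator {0..1} y * (\<psi> y * x ((y + real k) / 2 ^ j)))"
proof -
  have "\<psi> y = 0" if "y \<notin> {0..1}" for y using assms closure_subset[of "{s. \<psi> s \<noteq> 0}"] that by auto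
  then have eq: "x ((y + real k) / 2 ^ j) * \<psi> (2 ^ j * ((y + real k) / 2 ^ j) - real k) =
      indicator {0..1} y * (\<psi> y * x ((y + real k) / 2 ^ j))" for y
    by (auto simp: indicator_def)
  show ?thesis unfolding wavelet_coeff_def by (subst lborel_integral_cell[of _ j k]) (simp only: eq, simp)
qed

lemma wavelet_coeff_riemann_sum:
  assumes \<psi>: "continuous_on UNIV \<psi>" "closure {s. \<psi> s \<noteq> 0} \<subseteq> {0..1}" and x: "continuous_on UNIV x"
  shows "(\<lambda>n. \<Sum>i<n. \<psi> (real i / real n) / real n * x ((real i / real n + real k) / 2 ^ j)) \<longlonglongrightarrow> wavelet_coeff \<psi> x j k"
proof -
  have "continuous_on {0..1} (\<lambda>y. \<psi> y * x ((y + real k) / 2 ^ j))"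
    by (intro continuous_intros continuous_on_compose2[OF x] continuous_on_subset[OF \<psi>(1)]) auto
  from riemann_sum_tendsto_integral[OF this] show ?thesis
    by (simp add: wavelet_coeff_eq_integral_unit_interval[OF \<psi>(2)])
qed

lemma (in prob_space) tendsto_imp_prob_tendsto_0:
  fixes R :: "nat \<Rightarrow> 'a \<Rightarrow> real"
  assumes [measurable]: "\<And>n. R n \<in> borel_measurable M" "d \<in> borel_measurable M"
    and lim: "\<And>\<omega>. \<omega> \<in> space M \<Longrightarrow> (\<lambda>n. R n \<omega>) \<longlonglongrightarrow> d \<omega>" and \<delta>: "\<delta> > 0"
  shows "(\<lambda>n. prob {\<omega> \<in> space M. \<bar>R n \<omega> - d \<omega>\<bar> > \<delta>}) \<longlonglongrightarrow> 0"
proof -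
  let ?A = "\<lambda>n. {\<omega> \<in> space M. \<bar>R n \<omega> - d \<omega>\<bar> > \<delta>}"
  have "(\<lambda>n. expectation (indicator (?A n) :: 'a \<Rightarrow> real)) \<longlonglongrightarrow> expectation (\<lambda>_. 0 :: real)"
  proof (rule integral_dominated_convergence[where w="\<lambda>_. 1"])
    show "AE \<omega> in M. (\<lambda>n. indicator (?A n) \<omega> :: real) \<longlonglongrightarrow> 0"
    proof (rule AE_I2)
      fix \<omega> assume \<omega>: "\<omega> \<in> space M"
      have "\<forall>\<^sub>F n in sequentially. dist (R n \<omega>) (d \<omega>) < \<delta>" using tendstoD[OF lim[OF \<omega>] \<delta>] .
      then show "(\<lambda>n. indicator (?A n) \<omega> :: real) \<longlonglongrightarrow> 0"
        by (intro tendsto_eventually) (auto simp: dist_real_def elim!: eventually_mono)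
    qed
  qed (auto intro!: AE_I2 simp: indicator_def)
  then show ?thesis by simp
qed

lemma cell_borel [measurable]: "{real k / 2 ^ j ..< real (k + 1) / 2 ^ j} \<in> sets borel" by simp

lemma emeasure_cell: "emeasure lborel {real k / 2 ^ j ..< real (k + 1) / 2 ^ j} = ennreal (1 / 2 ^ j)"
  by (subst emeasure_lborel_Ico) (simp_all add: divide_right_mono diff_divide_distrib[symmetric])

lemma integrable_mult_cell_weight:
  assumes [measurable]: "f \<in> borel_measurable borel"
    and le: "\<And>s. s \<in> {real k / 2 ^ j ..< real (k + 1) / 2 ^ j} \<Longrightarrow> \<bar>f s\<bar> \<le> b"
  shows "integrable lborel (\<lambda>s. f s * cell_weight p j k s)"
proof (rule Bochner_Integration.integrable_bound)
  show "integrable lborel (\<lambda>s. b * indicator {real k / 2 ^ j ..< real (k + 1) / 2 ^ j} s :: real)"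
    by (intro integrable_mult_right integrable_real_indicator) (use emeasure_cell[of k j] in auto)
  show "AE s in lborel. norm (f s * cell_weight p j k s) \<le> norm (b * indicator {real k / 2 ^ j ..< real (k + 1) / 2 ^ j} s)"
  proof (rule AE_I2)
    fix s
    show "norm (f s * cell_weight p j k s) \<le> norm (b * indicator {real k / 2 ^ j ..< real (k + 1) / 2 ^ j} s)"
    proof (cases "s \<in> {real k / 2 ^ j ..< real (k + 1) / 2 ^ j}")
      case True
      then have "\<bar>f s\<bar> * \<bar>cell_weight p j k s\<bar> \<le> \<bar>b\<bar> * 1"
        using le[OF True] abs_cell_weight_le[of p j k s] by (intro mult_mono) auto
      then show ?thesis using True by (simp add: abs_mult)
    next
      case False
      then show ?thesis using abs_cell_weight_le[of p j k s] by simp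
    qed
  qed
qed measurable

lemma lfsm_kernel_measurable [measurable]: "lfsm_kernel H \<alpha> t \<in> borel_measurable borel"
  unfolding lfsm_kernel_def by measurable

lemma lfsm_kernel_eq_0: "0 \<le> s \<Longrightarrow> t \<le> s \<Longrightarrow> lfsm_kernel H \<alpha> t s = 0"
  by (simp add: lfsm_kernel_def)

context sas_random_measure
begin

text \<open>Rescaling the cell to [0,1) leaves j only in the powers of 2, so \<open>C\<close> is
  independent of j and k. The tolerance \<delta> is free so that the failures of all cells of one
  generation can be added up. Two approximations are chained, Riemann sums (index n) and step
  functions (index m); each uses half of \<rho> and of \<delta>.\<close>

lemma wavelet_coeff_approx:
  assumes \<alpha>: "1 < \<alpha>" and H: "1 / \<alpha> < H"
    and X: "linear_fractional_stable_motion M H \<alpha> Z X"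
    and \<psi>: "continuous_on UNIV \<psi>" "\<exists>s. \<psi> s \<noteq> 0" "closure {s. \<psi> s \<noteq> 0} \<subseteq> {0..1}"
  obtains C where "C > 0"
    "\<And>j k \<rho> \<delta>. \<rho> > 0 \<Longrightarrow> \<delta> > 0 \<Longrightarrow> \<exists>f. Bochner_Integration.simple_bochner_integrable lborel f \<and>
      (\<forall>s\<ge>real (k + 1) / 2 ^ j. f s = 0) \<and>
      prob {\<omega> \<in> space M. \<bar>simple_stable_integral Z f \<omega> - wavelet_coeff \<psi> (\<lambda>t. X t \<omega>) j k\<bar> > \<rho>} \<le> \<delta> \<and>
      ennreal (1 / 2 ^ j * (C * 2 powr (- real j * (H - 1 / \<alpha>))) powr \<alpha>) \<le>
      (\<integral>\<^sup>+ s. ennreal (\<bar>f s * indicator {real k / 2 ^ j ..< real (k + 1) / 2 ^ j} s\<bar> powr \<alpha>) \<partial>lborel)"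
proof -
  define \<kappa> where "\<kappa> = H - 1 / \<alpha>"
  have \<kappa>: "\<kappa> > 0" using H by (simp add: \<kappa>_def)
  obtain p :: nat where p: "(LINT y|lborel. indicator {0..1} y * (\<psi> y * y powr (\<kappa> + 1 + p))) \<noteq> 0"
    using exists_nonzero_moment[OF \<psi>, of "\<kappa> + 1"] \<kappa> by auto
  define I0 where "I0 = (LINT y|lborel. indicator {0..1} y * (\<psi> y * y powr (\<kappa> + 1 + p)))"
  obtain c where c: "c > 0" and cy: "\<And>y. y \<in> {0..1} \<Longrightarrow>
      (LINT x|lborel. max (y - x) 0 powr \<kappa> * (indicator {0..<1} x * x ^ p)) = c * y powr (\<kappa> + 1 + real p)"
    using exists_kernel_moment_constant[OF \<kappa>, of p] by blast
  \<comment> \<open>Each of the two approximations loses at most |L| / 4, which leaves |L| / 2 for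
    the tested integral; the other factor 2 is the one in the hypothesis of
    \<open>nn_integral_powr_ge\<close>.\<close>
  define C where "C = c * \<bar>I0\<bar> / 4"
  have C: "C > 0" using c p by (simp add: C_def I0_def)
  have Xm[measurable]: "X t \<in> borel_measurable M" for t
    using X by (simp add: linear_fractional_stable_motion_def has_stable_integral_def)
  have Xc: "continuous_on UNIV (\<lambda>t. X t \<omega>)" if "\<omega> \<in> space M" for \<omega>
    using X that by (simp add: linear_fractional_stable_motion_def)
  have "\<exists>f. Bochner_Integration.simple_bochner_integrable lborel f \<and>
      (\<forall>s\<ge>real (k + 1) / 2 ^ j. f s = 0) \<and>
      prob {\<omega> \<in> space M. \<bar>simple_stable_integral Z f \<omega> - wavelet_coeff \<psi> (\<lambda>t. X t \<omega>) j k\<bar> > \<rho>} \<le> \<delta> \<and>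
      ennreal (1 / 2 ^ j * (C * 2 powr (- real j * (H - 1 / \<alpha>))) powr \<alpha>) \<le>
      (\<integral>\<^sup>+ s. ennreal (\<bar>f s * indicator {real k / 2 ^ j ..< real (k + 1) / 2 ^ j} s\<bar> powr \<alpha>) \<partial>lborel)"
    if \<rho>: "\<rho> > 0" and \<delta>: "\<delta> > 0" for j k \<rho> \<delta>
  proof -
    \<comment> \<open>Riemann sums in \<open>t\<close> turn \<open>d\<close> into a combination of values of \<open>X\<close>. Applied to the kernel instead of to \<open>X\<close>, the same
      sums evaluate the functional \<open>h\<close>, so no stochastic Fubini theorem is needed.\<close>
    define h where "h = cell_weight p j k"
    define t where "t = (\<lambda>n i. (real i / real n + real k) / 2 ^ j)"
    define W where "W = (\<lambda>n i. \<psi> (real i / real n) / real n)"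
    define v where "v = (\<lambda>t. LINT s|lborel. lfsm_kernel H \<alpha> t s * h s)"
    define L where "L = 1 / 2 ^ j * (2 powr (- real j * \<kappa>) * (c * I0))"
    define R where "R = (\<lambda>n \<omega>. \<Sum>i<n. W n i * X (t n i) \<omega>)"
    define d where "d = (\<lambda>\<omega>. wavelet_coeff \<psi> (\<lambda>t. X t \<omega>) j k)"
    have hm: "h \<in> borel_measurable borel" by (simp add: h_def)
    have hD: "\<bar>h s\<bar> \<le> indicator {real k / 2 ^ j ..< real (k + 1) / 2 ^ j} s" for s
      unfolding h_def by (rule abs_cell_weight_le)
    have cell_finite: "emeasure lborel {real k / 2 ^ j ..< real (k + 1) / 2 ^ j} < \<infinity>"
      by (subst emeasure_cell) simp
    have L0: "L \<noteq> 0" using c p by (simp add: L_def I0_def)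
    have Rm[measurable]: "R n \<in> borel_measurable M" for n unfolding R_def by measurable
    have Rd: "(\<lambda>n. R n \<omega>) \<longlonglongrightarrow> d \<omega>" if "\<omega> \<in> space M" for \<omega>
      using wavelet_coeff_riemann_sum[OF \<psi>(1,3) Xc[OF that]] by (simp add: R_def W_def t_def d_def)
    have dm[measurable]: "d \<in> borel_measurable M" by (rule borel_measurable_LIMSEQ_real[OF Rd Rm])
    have vt: "v (t n i) = 1 / 2 ^ j * (2 powr (- real j * \<kappa>) * c) * (real i / n) powr (\<kappa> + 1 + p)" if "i < n" for n i
    proof -
      have "real i / n \<in> {0..1}" using that by simp
      from integral_lfsm_kernel_cell_weight[OF this] cy[OF this] show ?thesis
        by (simp add: v_def t_def h_def \<kappa>_def)
    qed
    have "(\<lambda>n. \<Sum>i<n. W n i * v (t n i)) \<longlonglongrightarrow> L"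
    proof -
      have "continuous_on {0..1} (\<lambda>y::real. y powr (\<kappa> + 1 + p))"
        using \<kappa> by (intro continuous_on_powr' continuous_intros) auto
      then have "continuous_on {0..1} (\<lambda>y. \<psi> y * y powr (\<kappa> + 1 + p))"
        by (intro continuous_on_mult continuous_on_subset[OF \<psi>(1)]) auto
      from tendsto_mult[OF tendsto_const[of "1 / 2 ^ j * (2 powr (- real j * \<kappa>) * c)"] riemann_sum_tendsto_integral[OF this]]
      have "(\<lambda>n. 1 / 2 ^ j * (2 powr (- real j * \<kappa>) * c) * (\<Sum>i<n. \<psi> (real i / n) * (real i / n) powr (\<kappa> + 1 + p) / n)) \<longlonglongrightarrow> L"
        by (simp add: L_def I0_def mult_ac)
      also have "(\<lambda>n. 1 / 2 ^ j * (2 powr (- real j * \<kappa>) * c) * (\<Sum>i<n. \<psi> (real i / n) * (real i / n) powr (\<kappa> + 1 + p) / n)) =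
        (\<lambda>n. \<Sum>i<n. W n i * v (t n i))"
        by (intro ext) (simp add: sum_distrib_left vt W_def mult_ac)
      finally show ?thesis .
    qed
    then have "\<forall>\<^sub>F n in sequentially. dist (\<Sum>i<n. W n i * v (t n i)) L < \<bar>L\<bar> / 4"
      using L0 by (intro tendstoD) auto
    moreover have "\<forall>\<^sub>F n in sequentially. prob {\<omega> \<in> space M. \<bar>R n \<omega> - d \<omega>\<bar> > \<rho> / 2} < \<delta> / 2"
      using order_tendstoD(2)[OF tendsto_imp_prob_tendsto_0[OF Rm dm Rd, of "\<rho> / 2"], of "\<delta> / 2"] \<rho> \<delta> by simp
    ultimately have "\<forall>\<^sub>F n in sequentially. dist (\<Sum>i<n. W n i * v (t n i)) L < \<bar>L\<bar> / 4 \<and>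
        prob {\<omega> \<in> space M. \<bar>R n \<omega> - d \<omega>\<bar> > \<rho> / 2} < \<delta> / 2" by (rule eventually_conj)
    then obtain n where n: "dist (\<Sum>i<n. W n i * v (t n i)) L < \<bar>L\<bar> / 4"
        "prob {\<omega> \<in> space M. \<bar>R n \<omega> - d \<omega>\<bar> > \<rho> / 2} < \<delta> / 2"
      unfolding eventually_sequentially by blast
    have "\<exists>F. \<forall>i. i < n \<longrightarrow> (\<forall>m. Bochner_Integration.simple_bochner_integrable lborel (F i m)) \<and>
       (\<forall>m s. real (k + 1) / 2 ^ j \<le> s \<longrightarrow> F i m s = 0) \<and>
       (\<lambda>m. \<integral>\<^sup>+ s. ennreal (\<bar>F i m s - lfsm_kernel H \<alpha> (t n i) s\<bar> powr \<alpha>) \<partial>lborel) \<longlonglongrightarrow> 0 \<and>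
       (\<forall>\<delta>>0. (\<lambda>m. prob {\<omega> \<in> space M. \<bar>simple_stable_integral Z (F i m) \<omega> - X (t n i) \<omega>\<bar> > \<delta>}) \<longlonglongrightarrow> 0)"
    proof (rule choice, intro allI)
      fix i
      show "\<exists>F. i < n \<longrightarrow> (\<forall>m. Bochner_Integration.simple_bochner_integrable lborel (F m)) \<and>
       (\<forall>m s. real (k + 1) / 2 ^ j \<le> s \<longrightarrow> F m s = 0) \<and>
       (\<lambda>m. \<integral>\<^sup>+ s. ennreal (\<bar>F m s - lfsm_kernel H \<alpha> (t n i) s\<bar> powr \<alpha>) \<partial>lborel) \<longlonglongrightarrow> 0 \<and>
       (\<forall>\<delta>>0. (\<lambda>m. prob {\<omega> \<in> space M. \<bar>simple_stable_integral Z (F m) \<omega> - X (t n i) \<omega>\<bar> > \<delta>}) \<longlonglongrightarrow> 0)"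
      proof (cases "i < n")
        case True
        \<comment> \<open>All nodes lie in the cell. Every kernel that occurs thus vanishes beyond
          its right end, and the step functions can be cut off at the same point for all i.\<close>
        then have tb: "t n i \<le> real (k + 1) / 2 ^ j" unfolding t_def by (intro divide_right_mono) auto
        have si: "has_stable_integral M \<alpha> Z (lfsm_kernel H \<alpha> (t n i)) (X (t n i))"
          using X by (simp add: linear_fractional_stable_motion_def)
        show ?thesis
        proof (rule has_stable_integral_approx[OF _ si])
          show "0 < \<alpha>" using \<alpha> by simp
          show "lfsm_kernel H \<alpha> (t n i) s = 0" if "real (k + 1) / 2 ^ j \<le> s" for s
            using tb that by (intro lfsm_kernel_eq_0) (auto intro: order_trans[of 0 "real (k + 1) / 2 ^ j"])
        qed blast
      qed simp
    qed
    then obtain F where F: "\<And>i m. i < n \<Longrightarrow> Bochner_Integration.simple_bochner_integrable lborel (F i m)"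
       "\<And>i m s. i < n \<Longrightarrow> real (k + 1) / 2 ^ j \<le> s \<Longrightarrow> F i m s = 0"
       "\<And>i. i < n \<Longrightarrow> (\<lambda>m. \<integral>\<^sup>+ s. ennreal (\<bar>F i m s - lfsm_kernel H \<alpha> (t n i) s\<bar> powr \<alpha>) \<partial>lborel) \<longlonglongrightarrow> 0"
       "\<And>i \<delta>. i < n \<Longrightarrow> \<delta> > 0 \<Longrightarrow> (\<lambda>m. prob {\<omega> \<in> space M. \<bar>simple_stable_integral Z (F i m) \<omega> - X (t n i) \<omega>\<bar> > \<delta>}) \<longlonglongrightarrow> 0"
      by blast
    define f where "f = (\<lambda>m s. \<Sum>i<n. W n i * F i m s)"
    have fs: "Bochner_Integration.simple_bochner_integrable lborel (f m)" for m
      unfolding f_def using F(1) by (intro simple_bochner_integrable_sum) auto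
    have Fm: "F i m \<in> borel_measurable borel" if "i < n" for i m
      using F(1)[OF that, of m] borel_measurable_simple_function[of lborel "F i m"]
      by (auto elim: simple_bochner_integrable.cases)
    have simple_int: "integrable lborel (\<lambda>s. u s * h s)"
      if u: "Bochner_Integration.simple_bochner_integrable lborel u" for u
    proof (rule Bochner_Integration.integrable_bound)
      show iu: "integrable lborel u"
        using has_bochner_integral_simple_bochner_integrable[OF u] by (auto simp: has_bochner_integral_iff)
      show "AE s in lborel. norm (u s * h s) \<le> norm (u s)"
      proof (rule AE_I2)
        fix s
        have "\<bar>h s\<bar> \<le> 1" using abs_cell_weight_le[of p j k s] unfolding h_def
          by (rule order_trans) (simp add: indicator_def)
        then have "\<bar>u s\<bar> * \<bar>h s\<bar> \<le> \<bar>u s\<bar> * 1" by (intro mult_left_mono) auto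
        then show "norm (u s * h s) \<le> norm (u s)" by (simp add: abs_mult)
      qed
      show "(\<lambda>s. u s * h s) \<in> borel_measurable lborel" using iu by (simp add: h_def)
    qed
    have ker_int: "integrable lborel (\<lambda>s. lfsm_kernel H \<alpha> \<tau> s * h s)" for \<tau>
      unfolding h_def
    proof (rule integrable_mult_cell_weight)
      fix s assume "s \<in> {real k / 2 ^ j ..< real (k + 1) / 2 ^ j}"
      then have s: "s \<ge> 0" by (auto intro: order_trans[of 0 "real k / 2 ^ j"])
      then show "\<bar>lfsm_kernel H \<alpha> \<tau> s\<bar> \<le> (max \<tau> 0) powr \<kappa>"
        using \<kappa> by (auto simp: lfsm_kernel_def \<kappa>_def intro!: powr_mono2)
    qed simp
    have "(\<lambda>m. LINT s|lborel. f m s * h s) \<longlonglongrightarrow> (\<Sum>i<n. W n i * v (t n i))"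
    proof -
      have "(\<lambda>m. LINT s|lborel. F i m s * h s) \<longlonglongrightarrow> v (t n i)" if i: "i < n" for i
        unfolding v_def
        by (rule tendsto_integral_of_powr_convergence[OF \<alpha> Fm[OF i] lfsm_kernel_measurable cell_borel cell_finite hm hD
              simple_int[OF F(1)[OF i]] ker_int F(3)[OF i]])
      then have "(\<lambda>m. \<Sum>i<n. W n i * (LINT s|lborel. F i m s * h s)) \<longlonglongrightarrow> (\<Sum>i<n. W n i * v (t n i))"
        by (intro tendsto_sum tendsto_mult tendsto_const) auto
      moreover have "(LINT s|lborel. f m s * h s) = (\<Sum>i<n. W n i * (LINT s|lborel. F i m s * h s))" for m
      proof -
        have "(LINT s|lborel. f m s * h s) = (LINT s|lborel. (\<Sum>i<n. W n i * (F i m s * h s)))"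
          by (simp add: f_def sum_distrib_right mult.assoc)
        also have "\<dots> = (\<Sum>i<n. LINT s|lborel. W n i * (F i m s * h s))"
          using simple_int[OF F(1)] by (intro Bochner_Integration.integral_sum integrable_mult_right) auto
        finally show ?thesis by simp
      qed
      ultimately show ?thesis by simp
    qed
    then have ev1: "\<forall>\<^sub>F m in sequentially. dist (LINT s|lborel. f m s * h s) (\<Sum>i<n. W n i * v (t n i)) < \<bar>L\<bar> / 4"
      using L0 by (intro tendstoD) auto
    have "(\<lambda>m. prob {\<omega> \<in> space M. \<bar>simple_stable_integral Z (f m) \<omega> - R n \<omega>\<bar> > \<rho> / 2}) \<longlonglongrightarrow> 0"
    proof -
      \<comment> \<open>Errors of at most \<eta> at all nodes add up to at most \<rho> / 2; the
        summand 1 keeps the denominator positive even if all weights are 0.\<close>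
      define \<eta> where "\<eta> = (\<rho> / 2) / (1 + (\<Sum>i<n. \<bar>W n i\<bar>))"
      have S0: "(\<Sum>i<n. \<bar>W n i\<bar>) \<ge> 0" by (intro sum_nonneg) auto
      have \<eta>: "\<eta> > 0" unfolding \<eta>_def using \<rho> S0 by (intro divide_pos_pos) linarith+
      have \<eta>S: "(1 + (\<Sum>i<n. \<bar>W n i\<bar>)) * \<eta> = \<rho> / 2"
      proof -
        have "1 + (\<Sum>i<n. \<bar>W n i\<bar>) \<noteq> 0" using S0 by linarith
        then have "\<eta> * (1 + (\<Sum>i<n. \<bar>W n i\<bar>)) = \<rho> / 2"
          by (rule nonzero_eq_divide_eq[THEN iffD1, OF _ \<eta>_def])
        then show ?thesis by (simp only: mult.commute)
      qed
      let ?E = "\<lambda>i m. {\<omega> \<in> space M. \<bar>simple_stable_integral Z (F i m) \<omega> - X (t n i) \<omega>\<bar> > \<eta>}"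
      have Em: "?E i m \<in> events" if "i < n" for i m
      proof -
        note [measurable] = borel_measurable_simple_stable_integral[OF F(1)[OF that, of m]]
        show ?thesis by measurable
      qed
      have lim: "(\<lambda>m. \<Sum>i<n. prob (?E i m)) \<longlonglongrightarrow> 0"
        using tendsto_sum[of "{..<n}" "\<lambda>i m. prob (?E i m)" "\<lambda>_. 0" sequentially] F(4) \<eta> by simp
      show ?thesis
      proof (rule tendsto_sandwich[OF _ _ tendsto_const lim]; intro always_eventually allI)
        fix m
        have AE: "AE \<omega> in M. simple_stable_integral Z (f m) \<omega> = (\<Sum>i<n. W n i * simple_stable_integral Z (F i m) \<omega>)"
          unfolding f_def using F(1) by (intro simple_stable_integral_sum) auto
        have "prob {\<omega> \<in> space M. \<bar>simple_stable_integral Z (f m) \<omega> - R n \<omega>\<bar> > \<rho> / 2} \<le> prob (\<Union>i\<in>{..<n}. ?E i m)"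
        proof (rule finite_measure_mono_AE)
          show "AE \<omega> in M. \<omega> \<in> {\<omega> \<in> space M. \<bar>simple_stable_integral Z (f m) \<omega> - R n \<omega>\<bar> > \<rho> / 2} \<longrightarrow>
            \<omega> \<in> (\<Union>i\<in>{..<n}. ?E i m)"
          proof (rule eventually_mono[OF AE], intro impI, rule ccontr)
            fix \<omega> assume eq: "simple_stable_integral Z (f m) \<omega> = (\<Sum>i<n. W n i * simple_stable_integral Z (F i m) \<omega>)"
              and gt: "\<omega> \<in> {\<omega> \<in> space M. \<bar>simple_stable_integral Z (f m) \<omega> - R n \<omega>\<bar> > \<rho> / 2}"
              and "\<omega> \<notin> (\<Union>i\<in>{..<n}. ?E i m)"
            then have le: "\<bar>simple_stable_integral Z (F i m) \<omega> - X (t n i) \<omega>\<bar> \<le> \<eta>" if "i < n" for i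
              using that by (auto simp: not_less)
            have "\<bar>simple_stable_integral Z (f m) \<omega> - R n \<omega>\<bar> = \<bar>\<Sum>i<n. W n i * (simple_stable_integral Z (F i m) \<omega> - X (t n i) \<omega>)\<bar>"
              by (simp add: eq R_def sum_subtractf right_diff_distrib)
            also have "\<dots> \<le> (\<Sum>i<n. \<bar>W n i\<bar> * \<eta>)"
              using le by (intro order_trans[OF sum_abs] sum_mono) (auto simp: abs_mult intro!: mult_left_mono)
            also have "\<dots> = (\<Sum>i<n. \<bar>W n i\<bar>) * \<eta>" by (rule sum_distrib_right[symmetric])
            also have "\<dots> \<le> \<rho> / 2" using \<eta>S \<eta> unfolding distrib_right by linarith
            finally show False using gt by simp
          qed
          show "(\<Union>i\<in>{..<n}. ?E i m) \<in> events" using Em by (intro sets.finite_UN) auto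
        qed
        also have "\<dots> \<le> (\<Sum>i<n. prob (?E i m))" using Em by (intro measure_UNION_le) auto
        finally show "prob {\<omega> \<in> space M. \<bar>simple_stable_integral Z (f m) \<omega> - R n \<omega>\<bar> > \<rho> / 2} \<le> (\<Sum>i<n. prob (?E i m))" .
      qed simp
    qed
    then have "\<forall>\<^sub>F m in sequentially. prob {\<omega> \<in> space M. \<bar>simple_stable_integral Z (f m) \<omega> - R n \<omega>\<bar> > \<rho> / 2} < \<delta> / 2"
      using order_tendstoD(2)[of _ 0 sequentially "\<delta> / 2"] \<delta> by auto
    with ev1 have "\<forall>\<^sub>F m in sequentially. dist (LINT s|lborel. f m s * h s) (\<Sum>i<n. W n i * v (t n i)) < \<bar>L\<bar> / 4 \<and>
       prob {\<omega> \<in> space M. \<bar>simple_stable_integral Z (f m) \<omega> - R n \<omega>\<bar> > \<rho> / 2} < \<delta> / 2"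
      by (rule eventually_conj)
    then obtain m where m: "dist (LINT s|lborel. f m s * h s) (\<Sum>i<n. W n i * v (t n i)) < \<bar>L\<bar> / 4"
       "prob {\<omega> \<in> space M. \<bar>simple_stable_integral Z (f m) \<omega> - R n \<omega>\<bar> > \<rho> / 2} < \<delta> / 2"
      unfolding eventually_sequentially by blast
    have fm: "f m \<in> borel_measurable borel"
      unfolding f_def using Fm by (intro borel_measurable_sum borel_measurable_times) auto
    show ?thesis
    proof (intro exI[of _ "f m"] conjI fs allI impI)
      show "f m s = 0" if "real (k + 1) / 2 ^ j \<le> s" for s using F(2) that by (simp add: f_def)
      note [measurable] = borel_measurable_simple_stable_integral[OF fs]
      have "prob {\<omega> \<in> space M. \<bar>simple_stable_integral Z (f m) \<omega> - d \<omega>\<bar> > \<rho>} \<le>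
        prob ({\<omega> \<in> space M. \<bar>simple_stable_integral Z (f m) \<omega> - R n \<omega>\<bar> > \<rho> / 2} \<union>
          {\<omega> \<in> space M. \<bar>R n \<omega> - d \<omega>\<bar> > \<rho> / 2})"
      proof (rule finite_measure_mono)
        show "{\<omega> \<in> space M. \<bar>simple_stable_integral Z (f m) \<omega> - d \<omega>\<bar> > \<rho>} \<subseteq>
          {\<omega> \<in> space M. \<bar>simple_stable_integral Z (f m) \<omega> - R n \<omega>\<bar> > \<rho> / 2} \<union> {\<omega> \<in> space M. \<bar>R n \<omega> - d \<omega>\<bar> > \<rho> / 2}"
        proof
          fix \<omega> assume *: "\<omega> \<in> {\<omega> \<in> space M. \<bar>simple_stable_integral Z (f m) \<omega> - d \<omega>\<bar> > \<rho>}"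
          have "\<bar>simple_stable_integral Z (f m) \<omega> - d \<omega>\<bar> \<le>
            \<bar>simple_stable_integral Z (f m) \<omega> - R n \<omega>\<bar> + \<bar>R n \<omega> - d \<omega>\<bar>"
            using abs_triangle_ineq[of "simple_stable_integral Z (f m) \<omega> - R n \<omega>" "R n \<omega> - d \<omega>"] by simp
          then show "\<omega> \<in> {\<omega> \<in> space M. \<bar>simple_stable_integral Z (f m) \<omega> - R n \<omega>\<bar> > \<rho> / 2} \<union> {\<omega> \<in> space M. \<bar>R n \<omega> - d \<omega>\<bar> > \<rho> / 2}"
            using * by auto
        qed
      qed measurable
      also have "\<dots> \<le> prob {\<omega> \<in> space M. \<bar>simple_stable_integral Z (f m) \<omega> - R n \<omega>\<bar> > \<rho> / 2} +
          prob {\<omega> \<in> space M. \<bar>R n \<omega> - d \<omega>\<bar> > \<rho> / 2}"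
        by (intro measure_Un_le) measurable
      also have "\<dots> \<le> \<delta>" using m(2) n(2) by simp
      finally show "prob {\<omega> \<in> space M. \<bar>simple_stable_integral Z (f m) \<omega> - wavelet_coeff \<psi> (\<lambda>t. X t \<omega>) j k\<bar> > \<rho>} \<le> \<delta>"
        by (simp add: d_def)
      show "ennreal (1 / 2 ^ j * (C * 2 powr (- real j * (H - 1 / \<alpha>))) powr \<alpha>) \<le>
        (\<integral>\<^sup>+ s. ennreal (\<bar>f m s * indicator {real k / 2 ^ j ..< real (k + 1) / 2 ^ j} s\<bar> powr \<alpha>) \<partial>lborel)"
      proof (rule nn_integral_powr_ge[OF \<alpha> fm cell_borel emeasure_cell _ hm hD])
        show "integrable lborel (\<lambda>s. f m s * h s)" by (rule simple_int[OF fs])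
        show "0 < C * 2 powr (- real j * (H - 1 / \<alpha>))" using C by simp
        have "\<bar>L\<bar> / 2 \<le> \<bar>LINT s|lborel. f m s * h s\<bar>"
          using m(1) n(1) unfolding dist_real_def by linarith
        moreover have "2 * (C * 2 powr (- real j * (H - 1 / \<alpha>))) * (1 / 2 ^ j) = \<bar>L\<bar> / 2"
          using c by (simp add: L_def C_def \<kappa>_def abs_mult mult_ac)
        ultimately show "2 * (C * 2 powr (- real j * (H - 1 / \<alpha>))) * (1 / 2 ^ j) \<le> \<bar>LINT s|lborel. f m s * h s\<bar>"
          by simp
      qed simp
    qed
  qed
  then show thesis using C by (intro that) auto
qed

end

section \<open>Dyadic levels and the Borel-Cantelli argument\<close>

lemma summable_exp_neg_geometric:
  fixes a r :: real
  assumes a: "a > 0" and r: "r > 1"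
  shows "summable (\<lambda>j. exp (- (a * r ^ j)))"
proof (rule summable_comparison_test')
  show "summable (\<lambda>j. 1 / a * (1 / r) ^ j)"
    using r by (intro summable_mult summable_geometric) auto
  fix j :: nat
  have pos: "a * r ^ j > 0" using a r by simp
  have "a * r ^ j \<le> exp (a * r ^ j)" using exp_ge_add_one_self[of "a * r ^ j"] by linarith
  then have "exp (- (a * r ^ j)) \<le> 1 / (a * r ^ j)" using pos by (simp add: exp_minus field_simps)
  then show "norm (exp (- (a * r ^ j))) \<le> 1 / a * (1 / r) ^ j" by (simp add: power_one_over)
qed

text \<open>The negative half-line belongs to level 0 (\<open>nat\<close> truncates), which can only increase the scale of the first cell.\<close>

definition dyadic_level :: "nat \<Rightarrow> real \<Rightarrow> nat" where
  "dyadic_level j s = min (2 ^ j) (nat \<lfloor>2 ^ j * s\<rfloor>)"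

text \<open>Capping at 2^j makes the range finite: all points from 1 on share one level, beyond
  those of the cells k < 2^j.\<close>

lemma simple_function_dyadic_level: "simple_function lborel (dyadic_level j)"
proof -
  have "range (dyadic_level j) \<subseteq> {..2 ^ j}" by (auto simp: dyadic_level_def)
  then have "finite (range (dyadic_level j))" by (rule finite_subset) simp
  moreover have "dyadic_level j \<in> measurable borel (count_space UNIV)"
    unfolding dyadic_level_def by measurable
  ultimately show ?thesis by (simp add: simple_function_eq_measurable)
qed

lemma dyadic_level_cell:
  assumes "k < 2 ^ j" "s \<in> {real k / 2 ^ j ..< real (k + 1) / 2 ^ j}"
  shows "dyadic_level j s = k"
proof -
  have "real k \<le> 2 ^ j * s" "2 ^ j * s < real k + 1" using assms(2) by (auto simp: field_simps)
  then have "\<lfloor>2 ^ j * s\<rfloor> = int k" by (simp add: floor_eq_iff)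
  then show ?thesis using assms(1) by (simp add: dyadic_level_def)
qed

text \<open>This provides adaptedness: points of level above k lie where the step function for the
  k-th cell has been cut off.\<close>

lemma less_dyadic_level_imp:
  assumes "k < dyadic_level j s"
  shows "real (k + 1) / 2 ^ j \<le> s"
proof -
  have "k < nat \<lfloor>2 ^ j * s\<rfloor>" using assms by (simp add: dyadic_level_def)
  then have "int (k + 1) \<le> \<lfloor>2 ^ j * s\<rfloor>" by linarith
  then have "real (k + 1) \<le> 2 ^ j * s" by (simp add: le_floor_iff)
  then show ?thesis by (simp add: field_simps)
qed

context sas_random_measure
begin

text \<open>The step-function estimate is applied with threshold 2 \<rho>, one \<rho> for the
  coefficient and one for its approximation. The mass of a cell divided by the threshold to the
  power \<alpha> is of order 2^{-j(1 - \<epsilon> \<alpha>)}, so that 2^j factors produce the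
  exponent 2^{j \<epsilon> \<alpha>}.\<close>

lemma prob_all_wavelet_coeff_le:
  assumes \<alpha>: "1 < \<alpha>" "\<alpha> < 2" and H: "1 / \<alpha> < H"
    and X: "linear_fractional_stable_motion M H \<alpha> Z X"
    and \<psi>: "continuous_on UNIV \<psi>" "\<exists>s. \<psi> s \<noteq> 0" "closure {s. \<psi> s \<noteq> 0} \<subseteq> {0..1}"
    and dm: "\<And>j k. (\<lambda>\<omega>. wavelet_coeff \<psi> (\<lambda>t. X t \<omega>) j k) \<in> borel_measurable M"
  obtains a where "a > 0" "\<And>\<epsilon> j. 0 < \<epsilon> \<Longrightarrow> \<epsilon> \<le> 1 / 2 \<Longrightarrow>
    prob {\<omega> \<in> space M. \<forall>k<2 ^ j. \<bar>wavelet_coeff \<psi> (\<lambda>t. X t \<omega>) j k\<bar> \<le> 2 powr (- (real j * (H - 1 / \<alpha> + \<epsilon>)))}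
      \<le> exp (- (a * (2 powr (\<epsilon> * \<alpha>)) ^ j))"
proof -
  obtain C where C: "C > 0" and approx:
    "\<And>j k \<rho> \<delta>. \<rho> > 0 \<Longrightarrow> \<delta> > 0 \<Longrightarrow> \<exists>f. Bochner_Integration.simple_bochner_integrable lborel f \<and>
      (\<forall>s\<ge>real (k + 1) / 2 ^ j. f s = 0) \<and>
      prob {\<omega> \<in> space M. \<bar>simple_stable_integral Z f \<omega> - wavelet_coeff \<psi> (\<lambda>t. X t \<omega>) j k\<bar> > \<rho>} \<le> \<delta> \<and>
      ennreal (1 / 2 ^ j * (C * 2 powr (- real j * (H - 1 / \<alpha>))) powr \<alpha>) \<le>
      (\<integral>\<^sup>+ s. ennreal (\<bar>f s * indicator {real k / 2 ^ j ..< real (k + 1) / 2 ^ j} s\<bar> powr \<alpha>) \<partial>lborel)"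
    by (rule wavelet_coeff_approx[OF \<alpha>(1) H X \<psi>]) (rule that; assumption)
  obtain c where c: "c > 0" "c \<le> 1" and small: "\<And>K f g u B.
     (\<And>k. k < K \<Longrightarrow> Bochner_Integration.simple_bochner_integrable lborel (f k)) \<Longrightarrow>
     simple_function lborel g \<Longrightarrow> (\<And>k s. k < K \<Longrightarrow> k < g s \<Longrightarrow> f k s = 0) \<Longrightarrow>
     0 < u \<Longrightarrow> 0 < B \<Longrightarrow> B \<le> 1 \<Longrightarrow>
     (\<And>k. k < K \<Longrightarrow> ennreal (B * u powr \<alpha>) \<le> (\<integral>\<^sup>+ s. ennreal (\<bar>f k s * indicator {s. g s = k} s\<bar> powr \<alpha>) \<partial>lborel)) \<Longrightarrow>
     prob {\<omega> \<in> space M. \<forall>k<K. \<bar>simple_stable_integral Z (f k) \<omega>\<bar> \<le> u} \<le> (1 - c * B / 2) ^ K"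
    by (fact prob_all_simple_stable_integral_le[OF \<alpha>])
  \<comment> \<open>C / 2 instead of C pays for the doubled threshold. The minimum with 1, together
    with \<epsilon> \<alpha> \<le> 1, ensures \<open>B \<le> 1\<close> below.\<close>
  define b where "b = min 1 ((C / 2) powr \<alpha>)"
  have b: "0 < b" "b \<le> 1" using C by (auto simp: b_def)
  have "prob {\<omega> \<in> space M. \<forall>k<2 ^ j. \<bar>wavelet_coeff \<psi> (\<lambda>t. X t \<omega>) j k\<bar> \<le> 2 powr (- (real j * (H - 1 / \<alpha> + \<epsilon>)))}
      \<le> exp (- (c * b / 2 * (2 powr (\<epsilon> * \<alpha>)) ^ j))"
    if \<epsilon>: "0 < \<epsilon>" "\<epsilon> \<le> 1 / 2" for \<epsilon> j
  proof -
    define \<kappa> where "\<kappa> = H - 1 / \<alpha>"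
    define \<rho> where "\<rho> = (2::real) powr (- (real j * (H - 1 / \<alpha> + \<epsilon>)))"
    define K :: nat where "K = 2 ^ j"
    define B where "B = b * 2 powr (real j * (\<epsilon> * \<alpha> - 1))"
    define d where "d = (\<lambda>k \<omega>. wavelet_coeff \<psi> (\<lambda>t. X t \<omega>) j k)"
    have [measurable]: "d k \<in> borel_measurable M" for k unfolding d_def by (rule dm)
    have \<rho>: "\<rho> > 0" by (simp add: \<rho>_def)
    have K: "K > 0" by (simp add: K_def)
    have "\<epsilon> * \<alpha> \<le> 1 / 2 * 2" using \<epsilon> \<alpha> by (intro mult_mono) auto
    then have "2 powr (real j * (\<epsilon> * \<alpha> - 1)) \<le> (2::real) powr 0"
      by (intro powr_mono) (auto simp: mult_nonneg_nonpos)
    then have B: "0 < B" "B \<le> 1" using b by (auto simp: B_def intro!: mult_le_one)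
    have scale: "B * (2 * \<rho>) powr \<alpha> \<le> 1 / 2 ^ j * (C * 2 powr (- real j * (H - 1 / \<alpha>))) powr \<alpha>"
    proof -
      have "B * (2 * \<rho>) powr \<alpha> = b * 2 powr \<alpha> * (2 powr (real j * (\<epsilon> * \<alpha> - 1)) * 2 powr (- (real j * (\<kappa> + \<epsilon>)) * \<alpha>))"
        by (simp add: B_def \<rho>_def powr_mult powr_powr \<kappa>_def)
      also have "\<dots> = b * 2 powr \<alpha> * 2 powr (- real j - real j * \<kappa> * \<alpha>)"
        by (simp add: algebra_simps flip: powr_add)
      also have "\<dots> \<le> (C / 2) powr \<alpha> * 2 powr \<alpha> * 2 powr (- real j - real j * \<kappa> * \<alpha>)"
        by (intro mult_right_mono) (auto simp: b_def)
      also have "(C / 2) powr \<alpha> * 2 powr \<alpha> = C powr \<alpha>" using C by (simp flip: powr_mult)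
      also have "C powr \<alpha> * 2 powr (- real j - real j * \<kappa> * \<alpha>) = 1 / 2 ^ j * (C * 2 powr (- real j * \<kappa>)) powr \<alpha>"
      proof -
        have "(C * 2 powr (- real j * \<kappa>)) powr \<alpha> = C powr \<alpha> * 2 powr (- (real j * \<kappa> * \<alpha>))"
          using C by (simp add: powr_mult powr_powr)
        moreover have "(2::real) powr (- real j - real j * \<kappa> * \<alpha>) = 1 / 2 ^ j * 2 powr (- (real j * \<kappa> * \<alpha>))"
          unfolding diff_conv_add_uminus powr_add by (simp add: powr_minus_divide powr_realpow)
        ultimately show ?thesis by simp
      qed
      finally show ?thesis by (simp add: \<kappa>_def)
    qed
    have "prob {\<omega> \<in> space M. \<forall>k<K. \<bar>d k \<omega>\<bar> \<le> \<rho>} \<le> (1 - c * B / 2) ^ K"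
    \<comment> \<open>For fixed j there are K cells, so approximations that fail with probability at
      most e / K fail together with probability at most e. The bound for the step functions does not
      depend on e, although the step functions do.\<close>
    proof (rule field_le_epsilon)
      fix e :: real assume e: "e > 0"
      have "\<exists>f. \<forall>k. Bochner_Integration.simple_bochner_integrable lborel (f k) \<and>
        (\<forall>s\<ge>real (k + 1) / 2 ^ j. f k s = 0) \<and>
        prob {\<omega> \<in> space M. \<bar>simple_stable_integral Z (f k) \<omega> - d k \<omega>\<bar> > \<rho>} \<le> e / K \<and>
        ennreal (1 / 2 ^ j * (C * 2 powr (- real j * (H - 1 / \<alpha>))) powr \<alpha>) \<le>
        (\<integral>\<^sup>+ s. ennreal (\<bar>f k s * indicator {real k / 2 ^ j ..< real (k + 1) / 2 ^ j} s\<bar> powr \<alpha>) \<partial>lborel)"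
        unfolding d_def using \<rho> e K by (intro choice allI approx) auto
      then obtain f where f: "\<And>k. Bochner_Integration.simple_bochner_integrable lborel (f k)"
        "\<And>k s. real (k + 1) / 2 ^ j \<le> s \<Longrightarrow> f k s = 0"
        "\<And>k. prob {\<omega> \<in> space M. \<bar>simple_stable_integral Z (f k) \<omega> - d k \<omega>\<bar> > \<rho>} \<le> e / K"
        "\<And>k. ennreal (1 / 2 ^ j * (C * 2 powr (- real j * (H - 1 / \<alpha>))) powr \<alpha>) \<le>
        (\<integral>\<^sup>+ s. ennreal (\<bar>f k s * indicator {real k / 2 ^ j ..< real (k + 1) / 2 ^ j} s\<bar> powr \<alpha>) \<partial>lborel)"
        by blast
      note [measurable] = borel_measurable_simple_stable_integral[OF f(1)]
      let ?E = "\<lambda>k. {\<omega> \<in> space M. \<bar>simple_stable_integral Z (f k) \<omega> - d k \<omega>\<bar> > \<rho>}"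
      let ?S = "{\<omega> \<in> space M. \<forall>k<K. \<bar>simple_stable_integral Z (f k) \<omega>\<bar> \<le> 2 * \<rho>}"
      have "prob {\<omega> \<in> space M. \<forall>k<K. \<bar>d k \<omega>\<bar> \<le> \<rho>} \<le> prob (?S \<union> (\<Union>k\<in>{..<K}. ?E k))"
      proof (rule finite_measure_mono)
        show "{\<omega> \<in> space M. \<forall>k<K. \<bar>d k \<omega>\<bar> \<le> \<rho>} \<subseteq> ?S \<union> (\<Union>k\<in>{..<K}. ?E k)"
        proof
          fix \<omega> assume \<omega>: "\<omega> \<in> {\<omega> \<in> space M. \<forall>k<K. \<bar>d k \<omega>\<bar> \<le> \<rho>}"
          show "\<omega> \<in> ?S \<union> (\<Union>k\<in>{..<K}. ?E k)"
          proof (rule ccontr)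
            assume no: "\<omega> \<notin> ?S \<union> (\<Union>k\<in>{..<K}. ?E k)"
            then obtain k where k: "k < K" "\<bar>simple_stable_integral Z (f k) \<omega>\<bar> > 2 * \<rho>" using \<omega> by (auto simp: not_le)
            moreover have "\<bar>simple_stable_integral Z (f k) \<omega> - d k \<omega>\<bar> \<le> \<rho>" using no k(1) \<omega> by (auto simp: not_less)
            moreover have "\<bar>d k \<omega>\<bar> \<le> \<rho>" using \<omega> k(1) by simp
            ultimately show False by linarith
          qed
        qed
      qed measurable
      also have "\<dots> \<le> prob ?S + prob (\<Union>k\<in>{..<K}. ?E k)" by (intro measure_Un_le) measurable
      also have "prob (\<Union>k\<in>{..<K}. ?E k) \<le> (\<Sum>k<K. prob (?E k))" by (intro measure_UNION_le) auto
      also have "\<dots> \<le> (\<Sum>k<K. e / K)" by (intro sum_mono f(3))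
      also have "\<dots> = e" using K by simp
      also have "prob ?S \<le> (1 - c * B / 2) ^ K"
      proof (rule small[OF f(1) simple_function_dyadic_level[of j]])
        show "f k s = 0" if "k < dyadic_level j s" for k s
          using f(2) less_dyadic_level_imp[OF that] by blast
        show "ennreal (B * (2 * \<rho>) powr \<alpha>) \<le> (\<integral>\<^sup>+ s. ennreal (\<bar>f k s * indicator {s. dyadic_level j s = k} s\<bar> powr \<alpha>) \<partial>lborel)"
          if "k < K" for k
        proof -
          have "ennreal (B * (2 * \<rho>) powr \<alpha>) \<le>
            (\<integral>\<^sup>+ s. ennreal (\<bar>f k s * indicator {real k / 2 ^ j ..< real (k + 1) / 2 ^ j} s\<bar> powr \<alpha>) \<partial>lborel)"
            using ennreal_leI[OF scale] f(4)[of k] by (rule order_trans)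
          also have "\<dots> \<le> (\<integral>\<^sup>+ s. ennreal (\<bar>f k s * indicator {s. dyadic_level j s = k} s\<bar> powr \<alpha>) \<partial>lborel)"
          proof (rule nn_integral_mono)
            fix s
            show "ennreal (\<bar>f k s * indicator {real k / 2 ^ j ..< real (k + 1) / 2 ^ j} s\<bar> powr \<alpha>) \<le>
              ennreal (\<bar>f k s * indicator {s. dyadic_level j s = k} s\<bar> powr \<alpha>)"
            proof (cases "s \<in> {real k / 2 ^ j ..< real (k + 1) / 2 ^ j}")
              case True
              have "dyadic_level j s = k" using that True unfolding K_def by (rule dyadic_level_cell)
              then show ?thesis using True by simp
            qed simp
          qed
          finally show ?thesis .
        qed
      qed (use \<rho> B in auto)
      finally show "prob {\<omega> \<in> space M. \<forall>k<K. \<bar>d k \<omega>\<bar> \<le> \<rho>} \<le> (1 - c * B / 2) ^ K + e" by simp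
    qed
    also have "\<dots> \<le> exp (- (c * B / 2)) ^ K"
    proof (rule power_mono)
      show "1 - c * B / 2 \<le> exp (- (c * B / 2))" using exp_ge_add_one_self[of "- (c * B / 2)"] by simp
      have "c * B \<le> 1" using c B by (intro mult_le_one) auto
      then show "0 \<le> 1 - c * B / 2" by simp
    qed
    also have "\<dots> = exp (- (c * b / 2 * (2 powr (\<epsilon> * \<alpha>)) ^ j))"
    proof -
      have "real K * B = b * (2 powr (\<epsilon> * \<alpha>)) ^ j"
        by (simp add: K_def B_def right_diff_distrib powr_diff powr_realpow powr_powr mult_ac flip: powr_realpow)
      then have "real K * (- (c * B / 2)) = - (c * b / 2 * (2 powr (\<epsilon> * \<alpha>)) ^ j)" by (simp add: mult_ac)
      then show ?thesis by (simp only: exp_of_nat_mult[symmetric])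
    qed
    finally show ?thesis by (simp add: d_def \<rho>_def K_def)
  qed
  then show thesis using b c by (intro that[of "c * b / 2"]) auto
qed

lemma AE_max_wavelet_coeff_gt:
  assumes \<alpha>: "1 < \<alpha>" "\<alpha> < 2" and H: "1 / \<alpha> < H"
    and X: "linear_fractional_stable_motion M H \<alpha> Z X"
    and \<psi>: "continuous_on UNIV \<psi>" "\<exists>s. \<psi> s \<noteq> 0" "closure {s. \<psi> s \<noteq> 0} \<subseteq> {0..1}"
    and \<epsilon>: "0 < \<epsilon>" "\<epsilon> \<le> 1 / 2"
  shows "AE \<omega> in M. \<forall>\<^sub>F j in sequentially.
    2 powr (- (real j * (H - 1 / \<alpha> + \<epsilon>))) < max_wavelet_coeff \<psi> (\<lambda>t. X t \<omega>) j"
proof -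
  have Xm: "X t \<in> borel_measurable M" for t
    using X by (simp add: linear_fractional_stable_motion_def has_stable_integral_def)
  \<comment> \<open>The pathwise integral is measurable as a pointwise limit of Riemann sums, each a
    finite combination of values of \<open>X\<close>.\<close>
  have dm[measurable]: "(\<lambda>\<omega>. wavelet_coeff \<psi> (\<lambda>t. X t \<omega>) j k) \<in> borel_measurable M" for j k
  proof (rule borel_measurable_LIMSEQ_real)
    show "(\<lambda>n. \<Sum>i<n. \<psi> (real i / real n) / real n * X ((real i / real n + real k) / 2 ^ j) \<omega>)
        \<longlonglongrightarrow> wavelet_coeff \<psi> (\<lambda>t. X t \<omega>) j k" if "\<omega> \<in> space M" for \<omega>
      using X that by (intro wavelet_coeff_riemann_sum \<psi>) (simp add: linear_fractional_stable_motion_def)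
  qed (use Xm in measurable)
  obtain a where a: "a > 0" and le: "\<And>\<epsilon> j. 0 < \<epsilon> \<Longrightarrow> \<epsilon> \<le> 1 / 2 \<Longrightarrow>
    prob {\<omega> \<in> space M. \<forall>k<2 ^ j. \<bar>wavelet_coeff \<psi> (\<lambda>t. X t \<omega>) j k\<bar> \<le> 2 powr (- (real j * (H - 1 / \<alpha> + \<epsilon>)))}
      \<le> exp (- (a * (2 powr (\<epsilon> * \<alpha>)) ^ j))"
    by (rule prob_all_wavelet_coeff_le[OF \<alpha> H X \<psi> dm]) (rule that; assumption)
  let ?A = "\<lambda>j. {\<omega> \<in> space M. \<forall>k<2 ^ j. \<bar>wavelet_coeff \<psi> (\<lambda>t. X t \<omega>) j k\<bar> \<le> 2 powr (- (real j * (H - 1 / \<alpha> + \<epsilon>)))}"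
  have "summable (\<lambda>j. prob (?A j))"
  proof (rule summable_comparison_test')
    show "summable (\<lambda>j. exp (- (a * (2 powr (\<epsilon> * \<alpha>)) ^ j)))"
      using \<epsilon> \<alpha> by (intro summable_exp_neg_geometric a) simp
    show "norm (prob (?A j)) \<le> exp (- (a * (2 powr (\<epsilon> * \<alpha>)) ^ j))" for j
      using le[OF \<epsilon>] by simp
  qed
  then have "AE \<omega> in M. \<forall>\<^sub>F j in sequentially. \<omega> \<in> space M - ?A j"
    by (intro borel_cantelli_AE1) (auto simp: less_top[symmetric])
  then show ?thesis
  proof eventually_elim
    case (elim \<omega>)
    then show ?case
    proof eventually_elim
      case (elim j)
      then obtain k where k: "k < 2 ^ j"
        "2 powr (- (real j * (H - 1 / \<alpha> + \<epsilon>))) < \<bar>wavelet_coeff \<psi> (\<lambda>t. X t \<omega>) j k\<bar>"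
        by (auto simp: not_le)
      have "\<bar>wavelet_coeff \<psi> (\<lambda>t. X t \<omega>) j k\<bar> \<le> max_wavelet_coeff \<psi> (\<lambda>t. X t \<omega>) j"
        unfolding max_wavelet_coeff_def using k(1) by (intro Max_ge) auto
      then show ?case using k(2) by simp
    qed
  qed
qed

end

section \<open>One almost sure event for all \<epsilon>\<close>

theorem mainTheorem2:
  fixes M :: "'a measure" and \<alpha> H :: real
    and Z :: "real set \<Rightarrow> 'a \<Rightarrow> real" and X :: "real \<Rightarrow> 'a \<Rightarrow> real"
    and \<psi> :: "real \<Rightarrow> real"
  assumes "1 < \<alpha>" and "\<alpha> < 2" and "1 / \<alpha> < H" and "H < 1"
    and "sas_random_measure M \<alpha> Z"
    and "linear_fractional_stable_motion M H \<alpha> Z X"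
    and "continuous_on UNIV \<psi>" and "\<exists>s. \<psi> s \<noteq> 0"
    and "closure {s. \<psi> s \<noteq> 0} \<subseteq> {0..1}"
    and "(LINT s|lborel. \<psi> s) = 0" and "(LINT s|lborel. s * \<psi> s) = 0"
  shows "AE \<omega> in M. \<forall>\<epsilon>>0.
    liminf (\<lambda>j. ereal (2 powr (real j * (H - 1 / \<alpha> + \<epsilon>)) *
      max_wavelet_coeff \<psi> (\<lambda>t. X t \<omega>) j)) = \<infinity>"
proof -
  interpret sas_random_measure M \<alpha> Z by fact
  \<comment> \<open>Countably many exponents yield a single event of probability 1; n + 2 keeps them
    in (0, 1/2].\<close>
  have "AE \<omega> in M. \<forall>n::nat. \<forall>\<^sub>F j in sequentially.
      2 powr (- (real j * (H - 1 / \<alpha> + 1 / real (n + 2)))) < max_wavelet_coeff \<psi> (\<lambda>t. X t \<omega>) j"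
    unfolding AE_all_countable using assms
    by (intro allI AE_max_wavelet_coeff_gt) (auto simp: field_simps)
  then show ?thesis
  proof eventually_elim
    case (elim \<omega>)
    show ?case
    proof (intro allI impI)
      fix \<epsilon> :: real assume \<epsilon>: "\<epsilon> > 0"
      obtain n :: nat where n: "1 / real (Suc n) < \<epsilon>" using nat_approx_posE[OF \<epsilon>] by blast
      define \<eta> where "\<eta> = 1 / real (n + 2)"
      have "\<eta> \<le> 1 / real (Suc n)" unfolding \<eta>_def by (intro divide_left_mono) auto
      then have \<eta>: "\<eta> < \<epsilon>" using n by simp
      \<comment> \<open>Because \<eta> is strictly smaller than \<epsilon>, the lower bound obtained
        for \<eta> leaves the factor 2^{j(\<epsilon> - \<eta>)}, which turns boundedness from below
        into divergence.\<close>
      have "filterlim (\<lambda>j. (2 powr (\<epsilon> - \<eta>)) ^ j :: real) at_top sequentially"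
        using \<eta> by (intro filterlim_at_infinity_imp_filterlim_at_top filterlim_realpow_sequentially_gt1 always_eventually) auto
      moreover have "\<forall>\<^sub>F j in sequentially. (2 powr (\<epsilon> - \<eta>)) ^ j \<le>
          2 powr (real j * (H - 1 / \<alpha> + \<epsilon>)) * max_wavelet_coeff \<psi> (\<lambda>t. X t \<omega>) j"
        using elim[rule_format, of n]
      proof eventually_elim
        case (elim j)
        have "(2 powr (\<epsilon> - \<eta>)) ^ j = 2 powr (real j * (H - 1 / \<alpha> + \<epsilon>)) * 2 powr (- (real j * (H - 1 / \<alpha> + \<eta>)))"
          by (simp add: powr_powr algebra_simps flip: powr_realpow powr_add)
        also have "\<dots> \<le> 2 powr (real j * (H - 1 / \<alpha> + \<epsilon>)) * max_wavelet_coeff \<psi> (\<lambda>t. X t \<omega>) j"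
          using elim by (intro mult_left_mono) (auto simp: \<eta>_def)
        finally show ?case .
      qed
      ultimately have "filterlim (\<lambda>j. 2 powr (real j * (H - 1 / \<alpha> + \<epsilon>)) * max_wavelet_coeff \<psi> (\<lambda>t. X t \<omega>) j) at_top sequentially"
        by (rule filterlim_at_top_mono)
      then have "(\<lambda>j. ereal (2 powr (real j * (H - 1 / \<alpha> + \<epsilon>)) * max_wavelet_coeff \<psi> (\<lambda>t. X t \<omega>) j)) \<longlonglongrightarrow> \<infinity>"
        by (simp add: tendsto_PInfty_eq_at_top)
      then show "liminf (\<lambda>j. ereal (2 powr (real j * (H - 1 / \<alpha> + \<epsilon>)) *
          max_wavelet_coeff \<psi> (\<lambda>t. X t \<omega>) j)) = \<infinity>"
        by (intro lim_imp_Liminf) auto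
    qed
  qed
qed

end
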